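(* Let $m,c>0$, $N\geq 1$, let $\sigma_1,\dots,\sigma_N$ be distinct points of $\mathbb{R}^2$, let $\kappa_i>0$ for $i=1,\dots,N$, and let $\alpha>1$. Let $W:\mathbb{R}^2\to\mathbb{R}$ be of class $C^1$ such that there exists $M>0$ with $0<W(x)\leq M$ for every $x\in\mathbb{R}^2$, and $\nabla W(x)\to 0$ as $|x|\to+\infty$. Consider the equation $$\frac{\mathrm d}{\mathrm dt}\left(\frac{m\dot x}{\sqrt{1-|\dot x|^2/c^2}}\right)=-\sum_{i=1}^N\frac{\kappa_i(x-\sigma_i)}{|x-\sigma_i|^{\alpha+2}}+\nabla W(x),\qquad x\in\mathbb{R}^2\setminus\{\sigma_1,\dots,\sigma_N\}.\qquad(\ast)$$ Fix $h>0$ and a non-trivial homotopy class $[\gamma]\in\pi_1(\mathbb{R}^2\setminus\{\sigma_1,\dots,\sigma_N\})$. Then there exists a non-collision periodic solution of $(\ast)$ having energy $\mathfrak{E}=h+mc^2$ and belonging to the homotopy class $[\gamma]$.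
   Context: Let $V(x)=\sum_{i=1}^N\frac{\kappa_i}{\alpha|x-\sigma_i|^\alpha}+W(x)$ on $\mathbb{R}^2\setminus\{\sigma_1,\dots,\sigma_N\}$, so that the right-hand side of the equation is $\nabla V(x)$. A solution $x$ (with $|\dot x|<c$) has energy $\mathfrak{E}$ if $$\frac{mc^2}{\sqrt{1-|\dot x(t)|^2/c^2}}-V(x(t))=\mathfrak{E}\quad\text{for all }t.$$ Non-collision means $x(t)\neq\sigma_i$ for all $t\in\mathbb{R}$ and all $i$. A periodic solution $x$ "belongs to the homotopy class $[\gamma]$" if there is some period $T>0$ of $x$ (not prescribed and not necessarily minimal) such that the loop $x|_{[0,T]}$, after linear reparameterization of time to $[0,1]$, lies in the class $[\gamma]$, i.e. is freely homotopic to $\gamma$ as a closed loop in $\mathbb{R}^2\setminus\{\sigma_1,\dots,\sigma_N\}$ (no base point is fixed). *)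

theory Defs
  imports "HOL-Analysis.Analysis"
begin

definition punctured_plane :: "nat \<Rightarrow> (nat \<Rightarrow> real^2) \<Rightarrow> (real^2) set" where
  "punctured_plane N \<sigma> = UNIV - \<sigma> ` {1..N}"

definition potential ::
  "nat \<Rightarrow> (nat \<Rightarrow> real^2) \<Rightarrow> (nat \<Rightarrow> real) \<Rightarrow> real \<Rightarrow> (real^2 \<Rightarrow> real) \<Rightarrow> real^2 \<Rightarrow> real" where
  "potential N \<sigma> \<kappa> \<alpha> W x =
     (\<Sum>i=1..N. \<kappa> i / (\<alpha> * norm (x - \<sigma> i) powr \<alpha>)) + W x"

text \<open>The argument \<open>gradW\<close> is the gradient field of the regular part \<open>W\<close> of the potential.\<close>

definition force ::
  "nat \<Rightarrow> (nat \<Rightarrow> real^2) \<Rightarrow> (nat \<Rightarrow> real) \<Rightarrow> real \<Rightarrow> (real^2 \<Rightarrow> real^2) \<Rightarrow> real^2 \<Rightarrow> real^2" where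
  "force N \<sigma> \<kappa> \<alpha> gradW x =
     - (\<Sum>i=1..N. (\<kappa> i / norm (x - \<sigma> i) powr (\<alpha> + 2)) *\<^sub>R (x - \<sigma> i)) + gradW x"

definition velocity :: "(real \<Rightarrow> real^2) \<Rightarrow> real \<Rightarrow> real^2" where
  "velocity x t = vector_derivative x (at t)"

definition momentum :: "real \<Rightarrow> real \<Rightarrow> (real \<Rightarrow> real^2) \<Rightarrow> real \<Rightarrow> real^2" where
  "momentum m c x t =
     (m / sqrt (1 - (norm (velocity x t))\<^sup>2 / c\<^sup>2)) *\<^sub>R velocity x t"

text \<open>Classical, globally defined solutions staying in \<open>S\<close>. Since the velocity is a continuous
  function of the momentum, such a solution is automatically of class \<open>C\<^sup>1\<close>, and of class
  \<open>C\<^sup>2\<close> if \<open>F\<close> is continuous on \<open>S\<close>.\<close>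

definition relativistic_solution ::
  "real \<Rightarrow> real \<Rightarrow> (real^2) set \<Rightarrow> (real^2 \<Rightarrow> real^2) \<Rightarrow> (real \<Rightarrow> real^2) \<Rightarrow> bool" where
  "relativistic_solution m c S F x \<longleftrightarrow>
     (\<forall>t. x t \<in> S \<and> x differentiable (at t) \<and> norm (velocity x t) < c \<and>
          (momentum m c x has_vector_derivative F (x t)) (at t))"

definition has_energy ::
  "real \<Rightarrow> real \<Rightarrow> (real^2 \<Rightarrow> real) \<Rightarrow> (real \<Rightarrow> real^2) \<Rightarrow> real \<Rightarrow> bool" where
  "has_energy m c V x E \<longleftrightarrow>
     (\<forall>t. m * c\<^sup>2 / sqrt (1 - (norm (velocity x t))\<^sup>2 / c\<^sup>2) - V (x t) = E)"

definition is_period :: "(real \<Rightarrow> real^2) \<Rightarrow> real \<Rightarrow> bool" where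
  "is_period x T \<longleftrightarrow> T > 0 \<and> (\<forall>t. x (t + T) = x t)"

definition loop_in :: "(real^2) set \<Rightarrow> (real \<Rightarrow> real^2) \<Rightarrow> bool" where
  "loop_in S \<gamma> \<longleftrightarrow> path \<gamma> \<and> path_image \<gamma> \<subseteq> S \<and> pathfinish \<gamma> = pathstart \<gamma>"

definition nontrivial_class :: "(real^2) set \<Rightarrow> (real \<Rightarrow> real^2) \<Rightarrow> bool" where
  "nontrivial_class S \<gamma> \<longleftrightarrow> \<not> (\<exists>a\<in>S. homotopic_loops S \<gamma> (\<lambda>_. a))"

text \<open>The period is not prescribed and need not be minimal, and \<open>homotopic_loops\<close> is
  free homotopy: no base point is kept fixed.\<close>

definition periodic_in_class ::
  "(real^2) set \<Rightarrow> (real \<Rightarrow> real^2) \<Rightarrow> (real \<Rightarrow> real^2) \<Rightarrow> bool" where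
  "periodic_in_class S \<gamma> x \<longleftrightarrow>
     (\<exists>T. is_period x T \<and> homotopic_loops S (\<lambda>s. x (T * s)) \<gamma>)"

end

theory Submission
  imports Defs "HOL-Complex_Analysis.Great_Picard"
begin

text \<open>By Maupertuis' principle the solutions of energy \<open>h + mc\<^sup>2\<close> are, up to a change of time, the
  geodesics of the metric \<open>U |dx|\<^sup>2\<close> with \<open>U = (h + mc\<^sup>2 + V)\<^sup>2 - (mc\<^sup>2)\<^sup>2\<close>. Since \<open>\<alpha> > 1\<close>, a loop that
  cannot be contracted is long in this metric when it comes close to a singularity, and since
  \<open>U \<ge> h\<^sup>2\<close> it is long when it goes far away; so a loop of bounded length in a nontrivial class
  stays in a compact set. Instead of minimising over curves, we minimise
  the discrete action \<open>n \<Sum> U(x\<^sub>j) |x\<^sub>j\<^sub>+\<^sub>1 - x\<^sub>j|\<^sup>2\<close> over closed \<open>n\<close>-gons in the class. The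
  discrete Euler--Lagrange equation bounds the first two difference quotients of the minimisers
  uniformly in \<open>n\<close>, so that by Arzela--Ascoli they converge, together with their discrete momenta, to
  a closed solution of the geodesic equation. Neither lower semicontinuity of the length nor
  regularity of minimisers is needed.\<close>

section \<open>Piecewise linear interpolation of periodic sequences\<close>

text \<open>The relativistic energy relation makes \<open>U\<close> quadratic in the potential, so
  at distance \<open>d\<close> from a centre \<open>U\<close> is of order
  \<open>d^(-2\<alpha>)\<close> and \<open>U d^2\<close> blows up exactly when \<alpha> > 1. For the
  Newtonian factor \<open>h + V\<close>, linear in the potential, the same condition would demand
  \<alpha> > 2.

  The action is preferred to the length because it is differentiable even where consecutive vertices
  coincide, and because its extremals come with a parametrisation of constant speed in the metric.
  The price of discretising is that \<open>U\<close> is sampled at vertices only: an edge could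
  cross a singularity unnoticed. This is excluded once \<open>n\<close> is large compared with the
  bound on the action.

  The parameter interval has length 1, so the closed extremal carries an energy constant
  \<open>e\<close> that is not under control. Only \<open>e > 0\<close> matters: the physical energy
  is already encoded in \<open>U\<close>, and the change of time absorbs \<open>e\<close> and
  produces the period.\<close>

lemma periodic_mult:
  fixes f :: "int \<Rightarrow> 'a"
  assumes "\<And>i. f (i + p) = f i"
  shows "f (i + k * p) = f i"
proof (induction k rule: int_induct [where k = 0])
  case (step1 k)
  have "f (i + (k + 1) * p) = f ((i + k * p) + p)" by (simp add: algebra_simps)
  then show ?case using step1 assms by simp
next
  case (step2 k)
  have "f (i + k * p) = f ((i + (k - 1) * p) + p)" by (simp add: algebra_simps)
  then show ?case using step2 assms by simp
qed simp

lemma periodic_mod: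
  fixes f :: "int \<Rightarrow> 'a"
  assumes "\<And>i. f (i + p) = f i"
  shows "f (i mod p) = f i"
  using periodic_mult [of f p "i mod p" "i div p", OF assms] by simp

lemma periodic_representative:
  fixes f :: "int \<Rightarrow> 'a"
  assumes "\<And>i. f (i + int n) = f i" "n > 0"
  shows "\<exists>j<n. f (int j) = f i"
proof (intro exI conjI)
  have "0 \<le> i mod int n" "i mod int n < int n" using assms by auto
  then show "nat (i mod int n) < n" "f (int (nat (i mod int n))) = f i"
    using periodic_mod [of f "int n", OF assms(1)] by auto
qed

lemma sum_periodic_shift:
  fixes f :: "int \<Rightarrow> 'a::ab_group_add"
  assumes per: "\<And>i. f (i + int n) = f i"
  shows "(\<Sum>j<n. f (i + int j)) = (\<Sum>j<n. f (int j))"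
proof -
  have step: "(\<Sum>j<n. f (i + 1 + int j)) = (\<Sum>j<n. f (i + int j))" for i
  proof -
    have "(\<Sum>j<n. f (i + int (Suc j))) + f i = (\<Sum>j<Suc n. f (i + int j))"
      by (subst sum.lessThan_Suc_shift) (simp add: add.commute)
    also have "\<dots> = (\<Sum>j<n. f (i + int j)) + f i"
      by (simp add: per)
    finally show ?thesis by (simp add: algebra_simps)
  qed
  show ?thesis
  proof (induction i rule: int_induct [where k = 0])
    case (step1 i) then show ?case using step [of i] by simp
  next
    case (step2 i) then show ?case using step [of "i - 1"] by simp
  qed simp
qed

lemma norm_diff_le_sum:
  fixes x :: "int \<Rightarrow> 'a::real_normed_vector"
  shows "norm (x (i + int k) - x i) \<le> (\<Sum>l<k. norm (x (i + int l + 1) - x (i + int l)))"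
proof (induction k)
  case (Suc k)
  have "x (i + int (Suc k)) - x i = (x (i + int k + 1) - x (i + int k)) + (x (i + int k) - x i)"
    by (simp add: algebra_simps)
  then have "norm (x (i + int (Suc k)) - x i) \<le>
      norm (x (i + int k + 1) - x (i + int k)) + norm (x (i + int k) - x i)"
    by (metis norm_triangle_ineq)
  then show ?case using Suc by simp
qed simp

definition interp :: "(int \<Rightarrow> 'a::real_vector) \<Rightarrow> real \<Rightarrow> 'a" where
  "interp x u = (1 - frac u) *\<^sub>R x \<lfloor>u\<rfloor> + frac u *\<^sub>R x (\<lfloor>u\<rfloor> + 1)"

lemma interp_of_int [simp]: "interp x (of_int i) = x i"
  by (simp add: interp_def)

lemma interp_of_nat [simp]: "interp x (of_nat i) = x (int i)"
  using interp_of_int [of x "int i"] by simp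

lemma interp_in_segment: "interp x u \<in> closed_segment (x \<lfloor>u\<rfloor>) (x (\<lfloor>u\<rfloor> + 1))"
  unfolding interp_def closed_segment_def using frac_lt_1 [of u] frac_ge_0 [of u]
  by (auto intro!: exI [of _ "frac u"])

lemma interp_diff: "interp (\<lambda>i. x i - y i) u = interp x u - interp y u"
  by (simp add: interp_def algebra_simps)

lemma interp_linear: "interp (\<lambda>i. of_int i *\<^sub>R a) u = u *\<^sub>R a"
  by (simp add: interp_def frac_def algebra_simps)

lemma interp_periodic:
  assumes "\<And>i. x (i + p) = x i"
  shows "interp x (u + of_int p) = interp x u"
  using assms [of "\<lfloor>u\<rfloor>"] assms [of "\<lfloor>u\<rfloor> + 1"]
  by (simp add: interp_def frac_def algebra_simps)

lemma norm_interp_le: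
  fixes x :: "int \<Rightarrow> 'a::real_normed_vector"
  assumes "norm (x \<lfloor>u\<rfloor>) \<le> e" "norm (x (\<lfloor>u\<rfloor> + 1)) \<le> e"
  shows "norm (interp x u) \<le> e"
proof -
  have "interp x u \<in> cball 0 e"
    using interp_in_segment [of x u] closed_segment_subset [of "x \<lfloor>u\<rfloor>" "cball 0 e" "x (\<lfloor>u\<rfloor> + 1)"] assms
    by (auto simp: convex_cball)
  then show ?thesis by simp
qed

text \<open>The bound is asked only for the edges met between \<open>u\<close> and \<open>v\<close>,
  because \<open>discrete_limit_derivative\<close> controls increments only near the point of
  differentiation.\<close>

lemma interp_lipschitz_on_window:
  fixes x :: "int \<Rightarrow> 'a::real_normed_vector"
  assumes "u \<le> v" and L: "\<And>i. \<lfloor>u\<rfloor> \<le> i \<Longrightarrow> i \<le> \<lfloor>v\<rfloor> \<Longrightarrow> norm (x (i + 1) - x i) \<le> L"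
  shows "norm (interp x v - interp x u) \<le> L * (v - u)"
proof -
  have grid: "norm (x (\<lfloor>u\<rfloor> + 1 + int k) - x (\<lfloor>u\<rfloor> + 1)) \<le> L * real k"
    if "\<lfloor>u\<rfloor> + int k \<le> \<lfloor>v\<rfloor>" for k
    using that
  proof (induction k)
    case (Suc k)
    have "norm (x (\<lfloor>u\<rfloor> + 1 + int k + 1) - x (\<lfloor>u\<rfloor> + 1 + int k)) \<le> L"
      using Suc.prems by (intro L) auto
    moreover have "norm (x (\<lfloor>u\<rfloor> + 1 + int k) - x (\<lfloor>u\<rfloor> + 1)) \<le> L * real k" using Suc by simp
    moreover have "x (\<lfloor>u\<rfloor> + 1 + int (Suc k)) - x (\<lfloor>u\<rfloor> + 1) =
        (x (\<lfloor>u\<rfloor> + 1 + int k + 1) - x (\<lfloor>u\<rfloor> + 1 + int k)) + (x (\<lfloor>u\<rfloor> + 1 + int k) - x (\<lfloor>u\<rfloor> + 1))"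
      by (simp add: algebra_simps)
    ultimately have "norm (x (\<lfloor>u\<rfloor> + 1 + int (Suc k)) - x (\<lfloor>u\<rfloor> + 1)) \<le> L + L * real k"
      by (simp only:) (rule order_trans [OF norm_triangle_ineq add_mono])
    then show ?case by (simp add: algebra_simps)
  qed simp
  have fl: "\<lfloor>u\<rfloor> \<le> \<lfloor>v\<rfloor>" using assms(1) floor_mono by blast
  show ?thesis
  proof (cases "\<lfloor>u\<rfloor> = \<lfloor>v\<rfloor>")
    case True
    then have "interp x v - interp x u = (v - u) *\<^sub>R (x (\<lfloor>u\<rfloor> + 1) - x \<lfloor>u\<rfloor>)"
      by (simp add: interp_def frac_def algebra_simps)
    then show ?thesis
      using mult_right_mono [OF L [of "\<lfloor>u\<rfloor>"], of "v - u"] fl assms(1) by (simp add: mult.commute)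
  next
    case False
    then have less: "\<lfloor>u\<rfloor> + 1 \<le> \<lfloor>v\<rfloor>" using fl by simp
    have 1: "norm (x (\<lfloor>u\<rfloor> + 1) - interp x u) \<le> L * (of_int (\<lfloor>u\<rfloor> + 1) - u)"
    proof -
      have "x (\<lfloor>u\<rfloor> + 1) - interp x u = (of_int (\<lfloor>u\<rfloor> + 1) - u) *\<^sub>R (x (\<lfloor>u\<rfloor> + 1) - x \<lfloor>u\<rfloor>)"
        by (simp add: interp_def frac_def algebra_simps)
      moreover have "of_int (\<lfloor>u\<rfloor> + 1) - u \<ge> 0" by linarith
      moreover have "norm (x (\<lfloor>u\<rfloor> + 1) - x \<lfloor>u\<rfloor>) \<le> L" using L [of "\<lfloor>u\<rfloor>"] fl by simp
      ultimately show ?thesis by (metis mult.commute mult_left_mono norm_scaleR abs_of_nonneg)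
    qed
    have 2: "norm (interp x v - x \<lfloor>v\<rfloor>) \<le> L * (v - of_int \<lfloor>v\<rfloor>)"
    proof -
      have "interp x v - x \<lfloor>v\<rfloor> = (v - of_int \<lfloor>v\<rfloor>) *\<^sub>R (x (\<lfloor>v\<rfloor> + 1) - x \<lfloor>v\<rfloor>)"
        by (simp add: interp_def frac_def algebra_simps)
      moreover have "v - of_int \<lfloor>v\<rfloor> \<ge> 0" by linarith
      moreover have "norm (x (\<lfloor>v\<rfloor> + 1) - x \<lfloor>v\<rfloor>) \<le> L" using L [of "\<lfloor>v\<rfloor>"] fl by simp
      ultimately show ?thesis by (metis mult.commute mult_left_mono norm_scaleR abs_of_nonneg)
    qed
    have 3: "norm (x \<lfloor>v\<rfloor> - x (\<lfloor>u\<rfloor> + 1)) \<le> L * (of_int \<lfloor>v\<rfloor> - of_int (\<lfloor>u\<rfloor> + 1))"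
      using grid [of "nat (\<lfloor>v\<rfloor> - \<lfloor>u\<rfloor> - 1)"] less by (simp add: algebra_simps)
    have "interp x v - interp x u = (interp x v - x \<lfloor>v\<rfloor>) + ((x \<lfloor>v\<rfloor> - x (\<lfloor>u\<rfloor> + 1)) + (x (\<lfloor>u\<rfloor> + 1) - interp x u))"
      by simp
    then have "norm (interp x v - interp x u) \<le> L * (v - of_int \<lfloor>v\<rfloor>) +
        (L * (of_int \<lfloor>v\<rfloor> - of_int (\<lfloor>u\<rfloor> + 1)) + L * (of_int (\<lfloor>u\<rfloor> + 1) - u))"
      by (simp only:) (intro order_trans [OF norm_triangle_ineq] add_mono 1 2 3)
    then show ?thesis by (simp add: algebra_simps)
  qed
qed

lemma interp_lipschitz:
  fixes x :: "int \<Rightarrow> 'a::real_normed_vector"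
  assumes "\<And>i. norm (x (i + 1) - x i) \<le> L"
  shows "norm (interp x v - interp x u) \<le> L * \<bar>v - u\<bar>"
  using interp_lipschitz_on_window [of u v x L] interp_lipschitz_on_window [of v u x L] assms
  by (cases "u \<le> v") (auto simp: norm_minus_commute)

lemma continuous_on_interp:
  fixes x :: "int \<Rightarrow> 'a::real_normed_vector"
  assumes L: "\<And>i. norm (x (i + 1) - x i) \<le> L"
  shows "continuous_on T (interp x)"
proof -
  have "L-lipschitz_on UNIV (interp x)"
    using interp_lipschitz [of x L, OF L] order_trans [OF norm_ge_zero L]
    by (intro lipschitz_onI) (simp_all add: dist_norm)
  then show ?thesis
    using continuous_on_subset lipschitz_on_continuous_on by blast
qed

lemma periodic_bounded:
  fixes f :: "int \<Rightarrow> real"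
  assumes "\<And>i. f (i + int n) = f i" "n > 0"
  obtains L where "\<And>i. f i \<le> L"
proof -
  have "f i \<le> Max ((\<lambda>j. f (int j)) ` {..<n})" for i
    using periodic_representative [of f n i, OF assms] by (metis Max_ge finite_imageI finite_lessThan imageI lessThan_iff)
  then show thesis using that by blast
qed

lemma continuous_on_interp_periodic:
  fixes x :: "int \<Rightarrow> 'a::real_normed_vector"
  assumes "\<And>i. x (i + int n) = x i" "n > 0"
  shows "continuous_on T (interp x)"
proof -
  have "norm (x (i + int n + 1) - x (i + int n)) = norm (x (i + 1) - x i)" for i
    using assms(1) [of "i + 1"] assms(1) [of i] by (simp add: algebra_simps)
  then obtain L where "\<And>i. norm (x (i + 1) - x i) \<le> L"
    using periodic_bounded [of "\<lambda>i. norm (x (i + 1) - x i)" n] assms(2) by blast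
  then show ?thesis by (rule continuous_on_interp)
qed

section \<open>Closed polygons and differentiability of their limits\<close>

definition polygon :: "nat \<Rightarrow> (int \<Rightarrow> 'a::real_vector) \<Rightarrow> real \<Rightarrow> 'a" where
  "polygon n x s = interp x (real n * s)"

lemma polygon_periodic:
  assumes "\<And>i. x (i + int n) = x i"
  shows "polygon n x (s + 1) = polygon n x s"
  using interp_periodic [of x "int n" "real n * s"] assms
  by (simp add: polygon_def algebra_simps)

lemma path_polygon:
  fixes x :: "int \<Rightarrow> 'a::real_normed_vector"
  assumes "\<And>i. x (i + int n) = x i" "n > 0"
  shows "path (polygon n x)"
  unfolding path_def polygon_def
  by (rule continuous_on_compose2 [OF continuous_on_interp_periodic [of x n UNIV]])
    (use assms in \<open>auto intro!: continuous_intros\<close>)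

lemma polygon_closed:
  assumes "\<And>i. x (i + int n) = x i"
  shows "pathfinish (polygon n x) = pathstart (polygon n x)"
  using polygon_periodic [of x n 0] assms by (simp add: pathfinish_def pathstart_def)

text \<open>A mean value estimate that survives the limit: after subtraction of the linear function
  with slope \<open>f s\<close>, all edges over a short interval around \<open>s\<close> have slope
  at most \<open>e\<close>. The corrected polygons are therefore \<open>e\<close>-Lipschitz there
  for all large \<open>k\<close>, and pointwise convergence hands this on to
  \<open>Y\<close>.\<close>

lemma discrete_limit_derivative:
  fixes y :: "nat \<Rightarrow> int \<Rightarrow> 'a::real_normed_vector"
  assumes n: "filterlim n at_top sequentially"
    and lim: "\<And>s. (\<lambda>k. polygon (n k) (y k) s) \<longlonglongrightarrow> Y s"
    and inc: "\<And>e. e > 0 \<Longrightarrow> \<forall>\<^sub>F k in sequentially.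
        \<forall>i. norm (real (n k) *\<^sub>R (y k (i + 1) - y k i) - f (of_int i / real (n k))) \<le> e"
    and f: "isCont f s"
  shows "(Y has_vector_derivative f s) (at s)"
  unfolding has_vector_derivative_def has_derivative_at_alt
proof (intro conjI allI impI)
  show "bounded_linear (\<lambda>h. h *\<^sub>R f s)" by (rule bounded_linear_scaleR_left)
next
  fix e :: real assume e: "e > 0"
  obtain d where d: "d > 0" "\<And>r. \<bar>r - s\<bar> < d \<Longrightarrow> norm (f r - f s) < e / 2"
    using f e unfolding continuous_at_eps_delta dist_norm by (metis half_gt_zero real_norm_def)
  have main: "norm ((Y v - v *\<^sub>R f s) - (Y u - u *\<^sub>R f s)) \<le> e * (v - u)"
    if uv: "u \<le> v" "s - d / 2 < u" "v < s + d / 2" for u v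
  proof -
    have "\<forall>\<^sub>F k in sequentially. real (n k) > 2 / d"
      using n filterlim_compose [OF filterlim_real_sequentially n]
      by (simp add: filterlim_at_top_dense)
    moreover have "\<forall>\<^sub>F k in sequentially.
        \<forall>i. norm (real (n k) *\<^sub>R (y k (i + 1) - y k i) - f (of_int i / real (n k))) \<le> e / 2"
      by (rule inc) (use e in simp)
    ultimately have "\<forall>\<^sub>F k in sequentially.
       norm ((polygon (n k) (y k) v - v *\<^sub>R f s) - (polygon (n k) (y k) u - u *\<^sub>R f s)) \<le> e * (v - u)"
    proof eventually_elim
      case (elim k)
      have nk: "real (n k) > 0" using elim(1) d(1) by (smt (verit) divide_pos_pos)
      \<comment> \<open>An edge met on \<open>[u, v]\<close> starts at a node that may lie up to
        \<open>1 / n\<close> to the left of \<open>u\<close>; half of \<open>d\<close> is kept in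
        reserve for it.\<close>
      have small: "1 / real (n k) < d / 2" using elim(1) d(1) nk by (simp add: field_simps)
      define z where "z i = y k i - of_int i *\<^sub>R ((1 / real (n k)) *\<^sub>R f s)" for i
      have z: "interp z (real (n k) * r) = polygon (n k) (y k) r - r *\<^sub>R f s" for r
        using nk unfolding z_def interp_diff interp_linear polygon_def by simp
      have "norm (interp z (real (n k) * v) - interp z (real (n k) * u))
            \<le> (e / real (n k)) * (real (n k) * v - real (n k) * u)"
      proof (rule interp_lipschitz_on_window)
        show "real (n k) * u \<le> real (n k) * v" using uv(1) by (simp add: mult_left_mono)
        fix i assume i: "\<lfloor>real (n k) * u\<rfloor> \<le> i" "i \<le> \<lfloor>real (n k) * v\<rfloor>"
        have "real (n k) * u - 1 < of_int i" "of_int i \<le> real (n k) * v" using i by linarith+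
        then have "u - 1 / real (n k) < of_int i / real (n k)" "of_int i / real (n k) \<le> v"
          using nk divide_strict_right_mono [of "real (n k) * u - 1" "of_int i" "real (n k)"]
          by (simp_all add: diff_divide_distrib pos_divide_le_eq mult.commute)
        then have "\<bar>of_int i / real (n k) - s\<bar> < d" using small uv by linarith
        then have 1: "norm (f (of_int i / real (n k)) - f s) < e / 2" by (rule d)
        have "z (i + 1) - z i = (1 / real (n k)) *\<^sub>R
            ((real (n k) *\<^sub>R (y k (i + 1) - y k i) - f (of_int i / real (n k)))
              + (f (of_int i / real (n k)) - f s))"
          using nk by (simp add: z_def algebra_simps add_divide_distrib flip: scaleR_add_left)
        moreover have "norm ((real (n k) *\<^sub>R (y k (i + 1) - y k i) - f (of_int i / real (n k)))
              + (f (of_int i / real (n k)) - f s)) \<le> e / 2 + e / 2"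
          by (intro order_trans [OF norm_triangle_ineq] add_mono elim(2) [rule_format] less_imp_le [OF 1])
        ultimately show "norm (z (i + 1) - z i) \<le> e / real (n k)"
          using nk by (simp add: divide_right_mono)
      qed
      then show ?case using nk unfolding z by (simp add: algebra_simps)
    qed
    moreover have "(\<lambda>k. (polygon (n k) (y k) v - v *\<^sub>R f s) - (polygon (n k) (y k) u - u *\<^sub>R f s))
       \<longlonglongrightarrow> (Y v - v *\<^sub>R f s) - (Y u - u *\<^sub>R f s)"
      by (intro tendsto_intros lim)
    ultimately show ?thesis
      using Lim_norm_ubound trivial_limit_sequentially by blast
  qed
  show "\<exists>d>0. \<forall>t. norm (t - s) < d \<longrightarrow> norm (Y t - Y s - (t - s) *\<^sub>R f s) \<le> e * norm (t - s)"
  proof (intro exI [of _ "d / 2"] conjI allI impI)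
    show "d / 2 > 0" using d by simp
    fix t assume t: "norm (t - s) < d / 2"
    show "norm (Y t - Y s - (t - s) *\<^sub>R f s) \<le> e * norm (t - s)"
    proof (cases "s \<le> t")
      case True
      then show ?thesis using main [of s t] t d(1) by (simp add: algebra_simps)
    next
      case False
      then show ?thesis using main [of t s] t d(1)
        by (simp add: algebra_simps norm_minus_commute)
    qed
  qed
qed

section \<open>Discrete loops and their action\<close>

text \<open>A closed polygon is encoded as a periodic sequence over the integers, so that cyclic
  shifts of the index need no wrap-around case.\<close>

definition discrete_loop :: "'a::real_normed_vector set \<Rightarrow> (real \<Rightarrow> 'a) \<Rightarrow> nat \<Rightarrow> (int \<Rightarrow> 'a) \<Rightarrow> bool" where
  "discrete_loop S \<gamma> n x \<longleftrightarrow>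
     n > 0 \<and> (\<forall>i. x (i + int n) = x i) \<and> homotopic_loops S (polygon n x) \<gamma>"

lemma polygon_vertex_in:
  assumes "path_image (polygon n x) \<subseteq> S" "\<And>i. x (i + int n) = x i" "n > 0"
  shows "x i \<in> S"
proof -
  obtain j where j: "j < n" "x (int j) = x i"
    using periodic_representative [of x n i] assms by blast
  have "polygon n x (real j / real n) = x (int j)"
    using assms(3) by (simp add: polygon_def)
  moreover have "real j / real n \<in> {0..1}" using j by simp
  ultimately have "x (int j) \<in> path_image (polygon n x)"
    unfolding path_image_def by (metis imageI)
  then show ?thesis using assms(1) j by auto
qed

lemma discrete_loop_vertex:
  assumes "discrete_loop S \<gamma> n x" shows "x i \<in> S"
  using assms polygon_vertex_in [of n x S i] homotopic_loops_imp_subset [of S "polygon n x" \<gamma>]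
  by (auto simp: discrete_loop_def)

text \<open>The image is compact, hence at positive distance from the complement of
  \<open>S\<close>; by convexity no point of a polygon moves further than its vertices do, so the
  straight-line homotopy stays in \<open>S\<close>. This openness of the class serves twice: for the
  limit of a minimising sequence, and for variations of a minimiser in both directions.\<close>

lemma polygon_homotopic_nearby:
  fixes x :: "int \<Rightarrow> 'a::euclidean_space"
  assumes per: "\<And>i. x (i + int n) = x i" "n > 0" and S: "open S" "path_image (polygon n x) \<subseteq> S"
  obtains e where "e > 0"
    "\<And>y. (\<And>i. y (i + int n) = y i) \<Longrightarrow> (\<And>i. norm (y i - x i) < e) \<Longrightarrow>
       homotopic_loops S (polygon n x) (polygon n y)"
proof -
  have "compact (path_image (polygon n x))" by (intro compact_path_image path_polygon per)
  moreover have "closed (- S)" using S(1) by (simp add: closed_def)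
  ultimately obtain d where d: "d > 0" "\<And>p z. p \<in> path_image (polygon n x) \<Longrightarrow> z \<in> - S \<Longrightarrow> d \<le> dist p z"
    using separate_compact_closed [of "path_image (polygon n x)" "- S"] S(2)
    by (metis Diff_eq Diff_eq_empty_iff)
  show thesis
  proof (rule that [of "d / 2"])
    fix y assume y: "\<And>i. y (i + int n) = y i" "\<And>i. norm (y i - x i) < d / 2"
    show "homotopic_loops S (polygon n x) (polygon n y)"
    proof (rule homotopic_loops_nearby_explicit)
      fix t :: real and p :: 'a assume t: "t \<in> {0..1}" and p: "p \<notin> S"
      have "norm (polygon n y t - polygon n x t) \<le> d / 2"
        unfolding polygon_def interp_diff [symmetric]
        by (intro norm_interp_le less_imp_le y)
      also have "\<dots> < d" using d by simp
      also have "d \<le> norm (polygon n x t - p)"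
        using d(2) [of "polygon n x t" p] t p by (simp add: path_image_def dist_norm)
      finally show "norm (polygon n y t - polygon n x t) < norm (polygon n x t - p)" .
    qed (use y per in \<open>auto intro: path_polygon polygon_closed\<close>)
  qed (use d in simp)
qed

text \<open>Tychonoff in place of a diagonal argument; the index type is countable, so the function
  space is first countable and compactness yields convergent subsequences.\<close>

lemma bounded_sequence_pointwise_convergent:
  fixes X :: "nat \<Rightarrow> 'i::countable \<Rightarrow> 'a::euclidean_space"
  assumes "\<And>k i. norm (X k i) \<le> R"
  obtains x and q :: "nat \<Rightarrow> nat" where "strict_mono q" "\<And>i. (\<lambda>k. X (q k) i) \<longlonglongrightarrow> x i"
proof -
  have "compactin (product_topology (\<lambda>_. euclidean) UNIV) (PiE UNIV (\<lambda>_::'i. cball (0::'a) R))"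
    by (simp add: compactin_PiE)
  then have "compact (PiE UNIV (\<lambda>_::'i. cball (0::'a) R))"
    by (simp add: euclidean_product_topology)
  then have "seq_compact (PiE UNIV (\<lambda>_::'i. cball (0::'a) R))"
    by (rule compact_imp_seq_compact)
  moreover have "\<forall>k. X k \<in> PiE UNIV (\<lambda>_::'i. cball (0::'a) R)"
    using assms by auto
  ultimately obtain x q where xq: "strict_mono (q::nat\<Rightarrow>nat)" "(X \<circ> q) \<longlonglongrightarrow> x"
    using seq_compactE by metis
  have "(\<lambda>k. X (q k) i) \<longlonglongrightarrow> x i" for i
  proof -
    have "isCont (\<lambda>f::'i \<Rightarrow> 'a. f i) x"
      by (rule continuous_on_interior [OF continuous_on_product_coordinates]) simp
    from isCont_tendsto_compose [OF this xq(2)] show ?thesis by (simp add: o_def)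
  qed
  with xq that show thesis by blast
qed

text \<open>The last assumption is a strong-force condition: it makes the loops around a point of \<open>Z\<close>
  arbitrarily long in the metric \<open>U |dx|\<^sup>2\<close> as they shrink.\<close>

locale singular_conformal_factor =
  fixes Z :: "'a::euclidean_space set" and U :: "'a \<Rightarrow> real" and G :: "'a \<Rightarrow> 'a" and u0 :: real
  assumes compact_Z: "compact Z" and Z_nonempty: "Z \<noteq> {}"
    and U_grad: "\<And>x. x \<notin> Z \<Longrightarrow> GDERIV U x :> G x"
    and G_cont: "continuous_on (- Z) G"
    and u0_pos: "u0 > 0" and U_ge: "\<And>x. x \<notin> Z \<Longrightarrow> u0 \<le> U x"
    and U_blowup: "\<And>B. \<exists>r>0. \<forall>x. x \<notin> Z \<longrightarrow> infdist x Z < r \<longrightarrow> B \<le> U x * (infdist x Z)\<^sup>2"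
begin

lemma open_compl_Z: "open (- Z)"
  using compact_Z by (simp add: compact_imp_closed open_Compl)

lemma U_pos: "x \<notin> Z \<Longrightarrow> U x > 0"
  using U_ge [of x] u0_pos by linarith

lemma isCont_U: "x \<notin> Z \<Longrightarrow> isCont U x"
  using U_grad [of x] has_derivative_continuous unfolding gderiv_def by blast

lemma infdist_Z_pos: "x \<notin> Z \<Longrightarrow> infdist x Z > 0"
  using in_closed_iff_infdist_zero [of Z x] compact_Z Z_nonempty infdist_nonneg [of x Z]
  by (auto simp: compact_imp_closed less_le)

lemma not_in_Z_if_infdist_pos: "infdist x Z > 0 \<Longrightarrow> x \<notin> Z"
  by auto

lemma ball_infdist: "ball x (infdist x Z) \<subseteq> - Z"
  using infdist_le [of _ Z x] by force

text \<open>The Riemann sum of \<open>U |x'|^2\<close> over \<open>[0, 1]\<close> with difference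
  quotients \<open>n (x (j + 1) - x j)\<close>: of the factor \<open>n^2\<close>, one
  \<open>n\<close> is used up by the mesh width. \<open>U\<close> is taken at the left end of each
  edge.\<close>

definition action :: "nat \<Rightarrow> (int \<Rightarrow> 'a) \<Rightarrow> real" where
  "action n x = real n * (\<Sum>j<n. U (x (int j)) * (norm (x (int j + 1) - x (int j)))\<^sup>2)"

lemma action_term_le:
  assumes per: "\<And>i. x (i + int n) = x i" "n > 0" and Z: "\<And>i. x i \<notin> Z"
  shows "real n * (U (x i) * (norm (x (i + 1) - x i))\<^sup>2) \<le> action n x"
proof -
  define g where "g i = U (x i) * (norm (x (i + 1) - x i))\<^sup>2" for i
  have "g (i + int n) = g i" for i
    using per(1) [of i] per(1) [of "i + 1"] by (simp add: g_def algebra_simps)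
  then obtain j where j: "j < n" "g (int j) = g i"
    using periodic_representative [of g n i] per(2) by blast
  have "g (int j) \<le> (\<Sum>j<n. g (int j))"
    using j U_pos Z by (intro member_le_sum) (auto simp: g_def less_imp_le)
  then show ?thesis using j per(2) by (simp add: action_def g_def)
qed

lemma action_nonneg:
  assumes "\<And>i. x i \<notin> Z"
  shows "0 \<le> action n x"
  unfolding action_def by (intro mult_nonneg_nonneg sum_nonneg less_imp_le [OF U_pos] assms) auto

text \<open>This keeps the edges of a polygon away from \<open>Z\<close>, although only its vertices enter \<open>U\<close> in the action.\<close>

lemma edge_small:
  obtains n0 where "n0 > 0" "\<And>n x i. n \<ge> n0 \<Longrightarrow> \<forall>i. x (i + int n) = x i \<Longrightarrow> \<forall>i. x i \<notin> Z \<Longrightarrow>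
     action n x \<le> C \<Longrightarrow> norm (x (i + 1) - x i) < infdist (x i) Z"
proof -
  obtain r where r: "r > 0" "\<And>x. x \<notin> Z \<Longrightarrow> infdist x Z < r \<Longrightarrow> \<bar>C\<bar> + 1 \<le> U x * (infdist x Z)\<^sup>2"
    using U_blowup [of "\<bar>C\<bar> + 1"] by blast
  obtain n0 where n0: "real n0 > \<bar>C\<bar> / (u0 * r\<^sup>2)" using reals_Archimedean2 by blast
  moreover have "\<bar>C\<bar> / (u0 * r\<^sup>2) \<ge> 0" using u0_pos by simp
  ultimately have "n0 > 0" by (intro gr0I) auto
  have "norm (x (i + 1) - x i) < infdist (x i) Z"
    if n: "n \<ge> n0" and per: "\<And>i. x (i + int n) = x i" and Z: "\<And>i. x i \<notin> Z"
      and C: "action n x \<le> C" for n x i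
  proof -
    let ?D = "(norm (x (i + 1) - x i))\<^sup>2" and ?d = "infdist (x i) Z"
    have np: "n > 0" using n \<open>n0 > 0\<close> by simp
    have le: "real n * (U (x i) * ?D) \<le> C"
      using action_term_le [of x n i] per np Z C by fastforce
    have Ux: "U (x i) > 0" using U_pos Z by blast
    \<comment> \<open>Near \<open>Z\<close> the blow-up already wins for a single term of the
      action, whatever \<open>n\<close> is. At distance at least \<open>r\<close> only
      \<open>U \<ge> u0\<close> is available, and there \<open>n0\<close> makes every edge shorter
      than \<open>r\<close>.\<close>
    have "?D < ?d\<^sup>2"
    proof (cases "?d < r")
      case True
      have "1 * (U (x i) * ?D) \<le> real n * (U (x i) * ?D)"
        using np Ux by (intro mult_right_mono) auto
      then have "U (x i) * ?D < U (x i) * ?d\<^sup>2" using r(2) [OF Z True] le by linarith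
      then show ?thesis using Ux by simp
    next
      case False
      have "\<bar>C\<bar> < real n0 * (u0 * r\<^sup>2)"
        using n0 u0_pos r(1) by (simp add: pos_divide_less_eq)
      also have "\<dots> \<le> real n * (u0 * r\<^sup>2)"
        using n u0_pos by (intro mult_right_mono) auto
      finally have "\<bar>C\<bar> < real n * (u0 * r\<^sup>2)" .
      moreover have "real n * (u0 * ?D) \<le> real n * (U (x i) * ?D)"
        using U_ge [OF Z [of i]] by (intro mult_left_mono mult_right_mono) auto
      ultimately have "real n * (u0 * ?D) < real n * (u0 * r\<^sup>2)" using le by linarith
      then have "?D < r\<^sup>2" using np u0_pos by simp
      also have "r\<^sup>2 \<le> ?d\<^sup>2" using False r(1) by (intro power_mono) auto
      finally show ?thesis .
    qed
    then show ?thesis using infdist_nonneg power2_less_imp_less by blast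
  qed
  with \<open>n0 > 0\<close> show thesis using that by blast
qed

lemma polygon_avoids_Z:
  assumes "\<And>i. norm (x (i + 1) - x i) < infdist (x i) Z"
  shows "path_image (polygon n x) \<subseteq> - Z"
proof -
  have "interp x u \<in> - Z" for u
  proof -
    have "infdist (x \<lfloor>u\<rfloor>) Z > 0" using assms [of "\<lfloor>u\<rfloor>"] norm_ge_zero order_le_less_trans by blast
    then have "closed_segment (x \<lfloor>u\<rfloor>) (x (\<lfloor>u\<rfloor> + 1)) \<subseteq> ball (x \<lfloor>u\<rfloor>) (infdist (x \<lfloor>u\<rfloor>) Z)"
      using assms [of "\<lfloor>u\<rfloor>"] by (intro closed_segment_subset) (auto simp: dist_norm norm_minus_commute)
    then show ?thesis using interp_in_segment [of x u] ball_infdist [of "x \<lfloor>u\<rfloor>"] by blast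
  qed
  then show ?thesis by (auto simp: path_image_def polygon_def)
qed

text \<open>Cauchy--Schwarz, for the length of the polygon in the metric \<open>U |dx|\<^sup>2\<close>.\<close>

lemma sum_length_le:
  assumes per: "\<And>i. x (i + int n) = x i" and Z: "\<And>i. x i \<notin> Z" and k: "k \<le> n"
  shows "(\<Sum>l<k. sqrt (U (x (i + int l))) * norm (x (i + int l + 1) - x (i + int l))) \<le> sqrt (action n x)"
proof -
  define g where "g i = sqrt (U (x i)) * norm (x (i + 1) - x i)" for i
  have g0: "g i \<ge> 0" for i using U_pos [OF Z [of i]] by (simp add: g_def)
  have "g (i + int n) = g i" for i
    using per [of i] per [of "i + 1"] by (simp add: g_def algebra_simps)
  then have shift: "(\<Sum>l<n. g (i + int l)) = (\<Sum>l<n. g (int l))" by (rule sum_periodic_shift)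
  have "(\<Sum>l<n. g (int l))\<^sup>2 \<le> (\<Sum>l<n. (g (int l))\<^sup>2) * real (card {..<n})"
    by (rule sum_squared_le_sum_of_squares)
  also have "\<dots> = action n x"
    using U_pos [OF Z] by (simp add: action_def g_def power_mult_distrib less_imp_le mult.commute)
  finally have "(\<Sum>l<n. g (int l)) \<le> sqrt (action n x)" by (rule real_le_rsqrt)
  moreover have "(\<Sum>l<k. g (i + int l)) \<le> (\<Sum>l<n. g (i + int l))"
    using k g0 by (intro sum_mono2) auto
  ultimately show ?thesis using shift by (simp add: g_def)
qed

text \<open>A polygon with all vertices in a ball avoiding \<open>Z\<close> would be contractible.\<close>

lemma far_vertex:
  assumes loop: "discrete_loop (- Z) \<gamma> n x"
    and nontrivial: "\<And>a. a \<notin> Z \<Longrightarrow> \<not> homotopic_loops (- Z) \<gamma> (\<lambda>_. a)"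
  obtains k where "k < n" "infdist (x i) Z \<le> norm (x (i + int k) - x i)"
    "\<And>l. l < k \<Longrightarrow> norm (x (i + int l) - x i) < infdist (x i) Z"
proof -
  have n: "n > 0" and per: "\<And>i. x (i + int n) = x i" and hom: "homotopic_loops (- Z) (polygon n x) \<gamma>"
    using loop by (auto simp: discrete_loop_def)
  let ?\<rho> = "infdist (x i) Z"
  have xi: "x i \<notin> Z" using discrete_loop_vertex [OF loop] by blast
  have "\<exists>k<n. ?\<rho> \<le> norm (x (i + int k) - x i)"
  proof (rule ccontr)
    assume "\<not> ?thesis"
    then have near: "k < n \<Longrightarrow> norm (x (i + int k) - x i) < ?\<rho>" for k by (meson not_le)
    have "x j \<in> ball (x i) ?\<rho>" for j
    proof -
      have "\<exists>k<n. x (i + int k) = x (i + (j - i))"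
      proof (rule periodic_representative)
        show "x (i + (l + int n)) = x (i + l)" for l using per [of "i + l"] by (simp add: add.assoc)
      qed (rule n)
      then obtain k where "k < n" "x (i + int k) = x j" by auto
      then show ?thesis using near [of k] by (simp add: dist_norm norm_minus_commute)
    qed
    then have "closed_segment (x j) (x (j + 1)) \<subseteq> ball (x i) ?\<rho>" for j
      by (intro closed_segment_subset convex_ball)
    then have "polygon n x t \<in> ball (x i) ?\<rho>" for t
      using interp_in_segment [of x] unfolding polygon_def by blast
    then have seg: "closed_segment (polygon n x t) (x i) \<subseteq> - Z" for t
      using closed_segment_subset [of "polygon n x t" "ball (x i) ?\<rho>" "x i"] ball_infdist [of "x i"]
        infdist_Z_pos [OF xi] by (meson centre_in_ball convex_ball order_trans)
    have "homotopic_loops (- Z) (polygon n x) (\<lambda>_. x i)"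
    proof (rule homotopic_loops_linear)
      show "path (\<lambda>_. x i)" by (simp add: path_def)
      show "path (polygon n x)" using per n by (rule path_polygon)
      show "pathfinish (polygon n x) = pathstart (polygon n x)" using per by (rule polygon_closed)
    qed (use seg in \<open>auto simp: pathfinish_def pathstart_def\<close>)
    then show False
      using nontrivial [OF xi] hom homotopic_loops_sym homotopic_loops_trans by blast
  qed
  then obtain k0 where k0: "k0 < n" "?\<rho> \<le> norm (x (i + int k0) - x i)" by blast
  define k where "k = (LEAST k. ?\<rho> \<le> norm (x (i + int k) - x i))"
  have "?\<rho> \<le> norm (x (i + int k) - x i)" unfolding k_def using k0(2) by (rule LeastI)
  moreover have "k < n" unfolding k_def using Least_le [of "\<lambda>k. ?\<rho> \<le> norm (x (i + int k) - x i)", OF k0(2)] k0(1) by simp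
  moreover have "norm (x (i + int l) - x i) < ?\<rho>" if "l < k" for l
    using not_less_Least [OF that [unfolded k_def]] by simp
  ultimately show thesis using that by blast
qed

section \<open>A priori compactness\<close>

text \<open>Let \<open>\<rho>\<close> be the distance of \<open>x i\<close> from \<open>Z\<close>.
  By \<open>far_vertex\<close> the polygon must travel at least \<open>\<rho>\<close> from
  \<open>x i\<close>, and before that it stays within distance \<open>2 \<rho>\<close> of
  \<open>Z\<close>. For small \<open>\<rho>\<close> the blow-up makes this stretch too long; for
  large \<open>\<rho>\<close> the bound \<open>U \<ge> u0\<close> does. The local fact
  \<open>len\<close> is the common length estimate, with \<open>w\<close> a lower bound for
  \<open>sqrt U\<close> on the stretch.\<close>

lemma discrete_loop_compactness:
  assumes nontrivial: "\<And>a. a \<notin> Z \<Longrightarrow> \<not> homotopic_loops (- Z) \<gamma> (\<lambda>_. a)"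
  obtains r R where "r > 0" "\<And>n x i. discrete_loop (- Z) \<gamma> n x \<Longrightarrow> action n x \<le> C \<Longrightarrow>
    r \<le> infdist (x i) Z \<and> norm (x i) \<le> R"
proof -
  \<comment> \<open>On the stretch \<open>sqrt U \<ge> sqrt B / (2 \<rho>)\<close>, so its length is
    at least \<open>sqrt B / 2\<close>; the factor 4 turns this into
    \<open>sqrt (\<bar>C\<bar> + 1)\<close>, which exceeds \<open>sqrt C\<close>.\<close>
  define B where "B = 4 * (\<bar>C\<bar> + 1)"
  obtain r where r: "r > 0" "\<And>x. x \<notin> Z \<Longrightarrow> infdist x Z < r \<Longrightarrow> B \<le> U x * (infdist x Z)\<^sup>2"
    using U_blowup [of B] by blast
  obtain M where M: "\<And>z. z \<in> Z \<Longrightarrow> norm z \<le> M"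
    using compact_imp_bounded [OF compact_Z] unfolding bounded_iff by blast
  have "r / 2 \<le> infdist (x i) Z \<and> norm (x i) \<le> M + sqrt C / sqrt u0"
    if loop: "discrete_loop (- Z) \<gamma> n x" and C: "action n x \<le> C" for n x i
  proof -
    let ?\<rho> = "infdist (x i) Z"
    have per: "\<And>i. x (i + int n) = x i" using loop by (simp add: discrete_loop_def)
    have Z: "x j \<notin> Z" for j using discrete_loop_vertex [OF loop] by blast
    obtain k where k: "k < n" "?\<rho> \<le> norm (x (i + int k) - x i)"
      "\<And>l. l < k \<Longrightarrow> norm (x (i + int l) - x i) < ?\<rho>"
      using far_vertex [OF loop nontrivial] by metis
    have \<rho>: "?\<rho> > 0" using infdist_Z_pos Z by blast
    have "C \<ge> 0" using action_nonneg [of x n] Z C by fastforce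
    have len: "w * ?\<rho> \<le> sqrt C"
      if w: "w \<ge> 0" "\<And>l. l < k \<Longrightarrow> w \<le> sqrt (U (x (i + int l)))" for w
    proof -
      have "w * ?\<rho> \<le> w * (\<Sum>l<k. norm (x (i + int l + 1) - x (i + int l)))"
        using k(2) norm_diff_le_sum [of x i k] w(1) by (intro mult_left_mono) auto
      also have "\<dots> \<le> (\<Sum>l<k. sqrt (U (x (i + int l))) * norm (x (i + int l + 1) - x (i + int l)))"
        unfolding sum_distrib_left using w(2) by (intro sum_mono mult_right_mono) auto
      also have "\<dots> \<le> sqrt (action n x)"
        using per Z k(1) by (intro sum_length_le) auto
      also have "\<dots> \<le> sqrt C" using C by simp
      finally show ?thesis .
    qed
    have "r / 2 \<le> ?\<rho>"
    proof (rule ccontr)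
      assume "\<not> r / 2 \<le> ?\<rho>"
      then have small: "2 * ?\<rho> < r" by simp
      have "sqrt B / (2 * ?\<rho>) * ?\<rho> \<le> sqrt C"
      proof (rule len)
        fix l assume "l < k"
        then have "norm (x (i + int l) - x i) < ?\<rho>" by (rule k)
        then have d: "infdist (x (i + int l)) Z \<le> 2 * ?\<rho>"
          using infdist_triangle [of "x (i + int l)" Z "x i"] by (simp add: dist_norm)
        have "B \<le> U (x (i + int l)) * (infdist (x (i + int l)) Z)\<^sup>2"
          using r(2) [OF Z] d small by auto
        also have "\<dots> \<le> U (x (i + int l)) * (2 * ?\<rho>)\<^sup>2"
          using d U_pos [OF Z] infdist_nonneg by (intro mult_left_mono power_mono) (auto simp: less_imp_le)
        finally have "B / (2 * ?\<rho>)\<^sup>2 \<le> U (x (i + int l))"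
          using \<rho> by (simp add: pos_divide_le_eq)
        then have "sqrt (B / (2 * ?\<rho>)\<^sup>2) \<le> sqrt (U (x (i + int l)))" by (rule real_sqrt_le_mono)
        then show "sqrt B / (2 * ?\<rho>) \<le> sqrt (U (x (i + int l)))"
          using \<rho> by (simp add: real_sqrt_divide real_sqrt_mult)
      qed (use \<rho> in \<open>simp add: B_def\<close>)
      moreover have "sqrt B / (2 * ?\<rho>) * ?\<rho> = sqrt (\<bar>C\<bar> + 1)"
        using \<rho> unfolding B_def real_sqrt_mult by simp
      moreover have "sqrt C < sqrt (\<bar>C\<bar> + 1)" by simp
      ultimately show False by linarith
    qed
    moreover have "?\<rho> \<le> sqrt C / sqrt u0"
      using len [of "sqrt u0"] u0_pos U_ge [OF Z] by (simp add: pos_le_divide_eq mult.commute less_imp_le)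
    moreover obtain z where "z \<in> Z" "?\<rho> = dist (x i) z"
      using infdist_attains_inf [of Z "x i"] compact_Z Z_nonempty compact_imp_closed by metis
    ultimately show ?thesis
      using M [of z] norm_triangle_ineq2 [of "x i" z] by (auto simp: dist_norm)
  qed
  then show thesis using that [of "r / 2"] r(1) by fastforce
qed

section \<open>Existence of minimal polygons\<close>

definition minimal_loop :: "(real \<Rightarrow> 'a) \<Rightarrow> nat \<Rightarrow> (int \<Rightarrow> 'a) \<Rightarrow> bool" where
  "minimal_loop \<gamma> n x \<longleftrightarrow> discrete_loop (- Z) \<gamma> n x \<and>
     (\<forall>y. discrete_loop (- Z) \<gamma> n y \<longrightarrow> action n x \<le> action n y)"

text \<open>Discrete form of \<open>U x'\<close>, half the derivative of the Lagrangian
  \<open>U |x'|^2\<close> in the velocity. The Euler--Lagrange equation bounds the increments of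
  this quantity directly.\<close>

definition discrete_momentum :: "nat \<Rightarrow> (int \<Rightarrow> 'a) \<Rightarrow> int \<Rightarrow> 'a" where
  "discrete_momentum n x i = (real n * U (x i)) *\<^sub>R (x (i + 1) - x i)"

text \<open>The direct method. The homotopy class is not closed under convergence of vertices, since
  an edge of the limit might meet \<open>Z\<close>. The compactness bound passes to the limit and
  keeps the vertices off \<open>Z\<close>; then \<open>edges\<close>, applied to the limit itself,
  keeps its edges off \<open>Z\<close>, and the limit is homotopic to late members of the
  sequence.\<close>

lemma discrete_minimiser:
  assumes nontrivial: "\<And>a. a \<notin> Z \<Longrightarrow> \<not> homotopic_loops (- Z) \<gamma> (\<lambda>_. a)"
    and edges: "\<And>x i. \<forall>i. x (i + int n) = x i \<Longrightarrow> \<forall>i. x i \<notin> Z \<Longrightarrow> action n x \<le> C \<Longrightarrow>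
      norm (x (i + 1) - x i) < infdist (x i) Z"
    and start: "discrete_loop (- Z) \<gamma> n x0" "action n x0 \<le> C"
  obtains x where "minimal_loop \<gamma> n x" "action n x \<le> C"
proof -
  obtain r R where r: "r > 0" and rR: "\<And>x i. discrete_loop (- Z) \<gamma> n x \<Longrightarrow> action n x \<le> C \<Longrightarrow>
    r \<le> infdist (x i) Z \<and> norm (x i) \<le> R"
    using discrete_loop_compactness [OF nontrivial, of C] by metis
  define D where "D = {x. discrete_loop (- Z) \<gamma> n x \<and> action n x \<le> C}"
  define a where "a = Inf (action n ` D)"
  have n: "n > 0" using start by (simp add: discrete_loop_def)
  have nonneg: "discrete_loop (- Z) \<gamma> n x \<Longrightarrow> 0 \<le> action n x" for x
    using discrete_loop_vertex by (intro action_nonneg) blast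
  have bdd: "bdd_below (action n ` D)" using nonneg by (auto simp: D_def intro!: bdd_belowI [of _ 0])
  have ne: "action n ` D \<noteq> {}" using start by (auto simp: D_def)
  have lower: "a \<le> action n x" if "x \<in> D" for x
    unfolding a_def using that bdd by (intro cInf_lower) auto
  have "\<exists>x. x \<in> D \<and> action n x < a + 1 / real (Suc k)" for k
    using cInf_lessD [OF ne, of "a + 1 / real (Suc k)"] by (auto simp: a_def)
  then obtain X where X: "\<And>k. X k \<in> D" "\<And>k. action n (X k) < a + 1 / real (Suc k)" by metis
  have "norm (X k i) \<le> R" for k i using X(1) rR by (auto simp: D_def)
  then obtain x q where q: "strict_mono (q :: nat \<Rightarrow> nat)" and lim: "\<And>i. (\<lambda>k. X (q k) i) \<longlonglongrightarrow> x i"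
    using bounded_sequence_pointwise_convergent [of X R] by metis
  have perX: "X k (i + int n) = X k i" for k i using X(1) by (auto simp: D_def discrete_loop_def)
  have per: "x (i + int n) = x i" for i
    using lim [of "i + int n"] lim [of i] LIMSEQ_unique by (auto simp: perX)
  have "r \<le> infdist (x i) Z" for i
  proof (rule tendsto_lowerbound)
    show "(\<lambda>k. infdist (X (q k) i) Z) \<longlonglongrightarrow> infdist (x i) Z"
      using lim by (rule tendsto_infdist)
  qed (use X(1) rR in \<open>auto simp: D_def\<close>)
  then have Z: "x i \<notin> Z" for i using r not_in_Z_if_infdist_pos order.strict_trans2 by blast
  have "(\<lambda>k. action n (X (q k))) \<longlonglongrightarrow> action n x"
    unfolding action_def by (intro tendsto_intros lim isCont_tendsto_compose [OF isCont_U [OF Z]])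
  moreover have "(\<lambda>k. action n (X (q k))) \<longlonglongrightarrow> a"
  proof (rule tendsto_sandwich)
    show "\<forall>\<^sub>F k in sequentially. a \<le> action n (X (q k))" using lower X(1) by simp
    show "\<forall>\<^sub>F k in sequentially. action n (X (q k)) \<le> a + 1 / real (Suc (q k))"
      using X(2) by (simp add: less_imp_le)
    have "(\<lambda>k. a + 1 / real (Suc k)) \<longlonglongrightarrow> a + 0"
      by (intro tendsto_intros LIMSEQ_Suc lim_1_over_n)
    from LIMSEQ_subseq_LIMSEQ [OF this q] show "(\<lambda>k. a + 1 / real (Suc (q k))) \<longlonglongrightarrow> a"
      by (simp add: o_def)
  qed simp
  ultimately have act: "action n x = a" using LIMSEQ_unique by blast
  have aC: "a \<le> C" using lower [of x0] start by (auto simp: D_def)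
  have img: "path_image (polygon n x) \<subseteq> - Z"
    using edges [of x] per Z act aC by (intro polygon_avoids_Z) auto
  obtain e where e: "e > 0" "\<And>y. (\<And>i. y (i + int n) = y i) \<Longrightarrow> (\<And>i. norm (y i - x i) < e) \<Longrightarrow>
       homotopic_loops (- Z) (polygon n x) (polygon n y)"
    using polygon_homotopic_nearby [OF per n open_compl_Z img] by metis
  have "\<forall>\<^sub>F k in sequentially. \<forall>j\<in>{..<n}. dist (X (q k) (int j)) (x (int j)) < e"
    using lim e(1) by (intro eventually_ball_finite ballI tendstoD) auto
  then obtain k where k: "\<And>j. j < n \<Longrightarrow> dist (X (q k) (int j)) (x (int j)) < e"
    by (auto simp: eventually_sequentially)
  have "norm (X (q k) i - x i) < e" for i
  proof -
    have "\<exists>j<n. (X (q k) (int j) - x (int j)) = X (q k) i - x i"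
      using periodic_representative [of "\<lambda>i. X (q k) i - x i" n i] perX per n by simp
    then show ?thesis using k by (metis dist_norm)
  qed
  then have "homotopic_loops (- Z) (polygon n x) (polygon n (X (q k)))" using e(2) perX by blast
  moreover have "homotopic_loops (- Z) (polygon n (X (q k))) \<gamma>" 
    using X(1) by (auto simp: D_def discrete_loop_def)
  ultimately have "discrete_loop (- Z) \<gamma> n x"
    using per n homotopic_loops_trans by (auto simp: discrete_loop_def)
  moreover have "action n x \<le> action n y" if "discrete_loop (- Z) \<gamma> n y" for y
    using lower [of y] that act aC by (cases "action n y \<le> C") (auto simp: D_def)
  ultimately have "minimal_loop \<gamma> n x" by (simp add: minimal_loop_def)
  then show thesis using that act aC by blast
qed

end

section \<open>The discrete Euler--Lagrange equation\<close>

lemma GDERIV_along_line: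
  assumes "GDERIV f p :> g"
  shows "((\<lambda>t. f (p + t *\<^sub>R w)) has_real_derivative w \<bullet> g) (at 0)"
proof -
  have "((\<lambda>t. p + t *\<^sub>R w) has_derivative (\<lambda>h. h *\<^sub>R w)) (at 0)"
    by (auto intro!: derivative_eq_intros)
  moreover have "(f has_derivative (\<lambda>h. h \<bullet> g)) (at (p + 0 *\<^sub>R w))"
    using assms by (simp add: gderiv_def)
  ultimately have "((\<lambda>t. f (p + t *\<^sub>R w)) has_derivative (\<lambda>h. (h *\<^sub>R w) \<bullet> g)) (at 0)"
    by (rule has_derivative_compose)
  then show ?thesis by (simp add: has_field_derivative_def mult_commute_abs)
qed

lemma DERIV_norm_square_along_line:
  fixes d v :: "'a::real_inner"
  shows "((\<lambda>t. (norm (d + t *\<^sub>R v))\<^sup>2) has_real_derivative 2 * (d \<bullet> v)) (at 0)"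
proof -
  have "(\<lambda>t. (norm (d + t *\<^sub>R v))\<^sup>2) = (\<lambda>t. d \<bullet> d + t * (2 * (d \<bullet> v)) + t\<^sup>2 * (v \<bullet> v))"
    unfolding power2_norm_eq_inner
    by (rule ext) (simp add: inner_add_left inner_add_right inner_commute [of v d] power2_eq_square algebra_simps)
  then show ?thesis by (auto intro!: derivative_eq_intros)
qed

context singular_conformal_factor
begin

text \<open>Since the class is open, a minimiser is a critical point for periodic variations.
  Sampling \<open>U\<close> at left ends pairs the gradient at \<open>x (i + 1)\<close> with the
  outgoing edge, which is why the edge from \<open>i + 1\<close> to \<open>i + 2\<close> appears on
  the right.\<close>

lemma discrete_euler_lagrange:
  assumes minimal: "minimal_loop \<gamma> n x"
  shows "discrete_momentum n x (i + 1) - discrete_momentum n x i =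
    (real n / 2 * (norm (x (i + 2) - x (i + 1)))\<^sup>2) *\<^sub>R G (x (i + 1))"
proof -
  have loop: "discrete_loop (- Z) \<gamma> n x"
    and minimal: "\<And>y. discrete_loop (- Z) \<gamma> n y \<Longrightarrow> action n x \<le> action n y"
    using minimal by (auto simp: minimal_loop_def)
  have n: "n > 0" and per: "\<And>i. x (i + int n) = x i" and hom: "homotopic_loops (- Z) (polygon n x) \<gamma>"
    using loop by (auto simp: discrete_loop_def)
  have Z: "x j \<notin> Z" for j using discrete_loop_vertex [OF loop] by blast
  have img: "path_image (polygon n x) \<subseteq> - Z" using homotopic_loops_imp_subset [OF hom] by blast
  define D where "D i = x (i + 1) - x i" for i
  have perD: "D (i + int n) = D i" for i
    using per [of i] per [of "i + 1"] by (simp add: D_def algebra_simps)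
  \<comment> \<open>The variation in the direction of the residual \<open>w\<close> is \<open>n\<close> times the sum of the \<open>|w\<^sub>j|\<^sup>2\<close>.\<close>
  define w where "w i = (norm (D i))\<^sup>2 *\<^sub>R G (x i) + (2 * U (x (i - 1))) *\<^sub>R D (i - 1) - (2 * U (x i)) *\<^sub>R D i" for i
  have perw: "w (i + int n) = w i" for i
    using per [of i] per [of "i - 1"] perD [of i] perD [of "i - 1"] by (simp add: w_def algebra_simps)
  \<comment> \<open>A common bound on the \<open>w i\<close> turns the tolerance \<open>e\<close>
    for the vertices into the tolerance \<open>e / (L + 1)\<close> for \<open>t\<close>; the
    \<open>+ 1\<close> covers \<open>L = 0\<close>.\<close>
  obtain L where L: "\<And>i. norm (w i) \<le> L"
    using periodic_bounded [of "\<lambda>i. norm (w i)" n] perw n by auto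
  then have L0: "L \<ge> 0" using norm_ge_zero order_trans by blast
  obtain e where e: "e > 0" "\<And>y. (\<And>i. y (i + int n) = y i) \<Longrightarrow> (\<And>i. norm (y i - x i) < e) \<Longrightarrow>
       homotopic_loops (- Z) (polygon n x) (polygon n y)"
    using polygon_homotopic_nearby [of x n "- Z"] per n open_compl_Z img by metis
  define \<phi> where "\<phi> t = action n (\<lambda>i. x i + t *\<^sub>R w i)" for t
  have "\<phi> 0 \<le> \<phi> t" if t: "\<bar>0 - t\<bar> < e / (L + 1)" for t
  proof -
    have "norm (x i + t *\<^sub>R w i - x i) < e" for i
    proof -
      have "norm (x i + t *\<^sub>R w i - x i) = \<bar>t\<bar> * norm (w i)" by simp
      also have "\<dots> \<le> \<bar>t\<bar> * (L + 1)" using L [of i] by (intro mult_left_mono) auto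
      also have "\<dots> < e" using t L0 by (simp add: pos_less_divide_eq)
      finally show ?thesis .
    qed
    then have "homotopic_loops (- Z) (polygon n x) (polygon n (\<lambda>i. x i + t *\<^sub>R w i))"
      by (intro e(2)) (simp_all add: per perw)
    then have "discrete_loop (- Z) \<gamma> n (\<lambda>i. x i + t *\<^sub>R w i)"
      using hom n homotopic_loops_trans [OF homotopic_loops_sym]
      by (simp add: discrete_loop_def per perw) blast
    then show ?thesis using minimal by (simp add: \<phi>_def)
  qed
  moreover have "(\<phi> has_real_derivative real n *
     (\<Sum>j<n. (w (int j) \<bullet> G (x (int j))) * (norm (D (int j)))\<^sup>2
         + 2 * (D (int j) \<bullet> (w (int j + 1) - w (int j))) * U (x (int j)))) (at 0)"
    (is "(\<phi> has_real_derivative real n * (\<Sum>j<n. ?t j)) (at 0)")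
  proof -
    have "\<phi> = (\<lambda>t. real n * (\<Sum>j<n. U (x (int j) + t *\<^sub>R w (int j)) *
        (norm (D (int j) + t *\<^sub>R (w (int j + 1) - w (int j))))\<^sup>2))"
      by (rule ext) (simp add: \<phi>_def action_def D_def algebra_simps)
    moreover have "((\<lambda>t. U (x (int j) + t *\<^sub>R w (int j)) *
        (norm (D (int j) + t *\<^sub>R (w (int j + 1) - w (int j))))\<^sup>2) has_real_derivative ?t j) (at 0)" for j
      using DERIV_mult [OF GDERIV_along_line [OF U_grad [OF Z [of "int j"]], of "w (int j)"]
          DERIV_norm_square_along_line [of "D (int j)" "w (int j + 1) - w (int j)"]]
      by (simp add: add.commute)
    ultimately show ?thesis by (auto intro!: DERIV_cmult DERIV_sum)
  qed
  moreover have "e / (L + 1) > 0" using e(1) L0 by simp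
  ultimately have zero: "real n * (\<Sum>j<n. ?t j) = 0"
    using DERIV_local_min [of \<phi> _ 0 "e / (L + 1)"] by blast
  \<comment> \<open>Summation by parts: \<open>g\<close> collects the terms in which an edge is
    paired with the variation of its right end. Reindexed by one, they join the terms at the left
    ends to form \<open>|w j|^2\<close>, and by periodicity the reindexing leaves no boundary
    term.\<close>
  define g where "g k = 2 * U (x k) * (D k \<bullet> w (k + 1))" for k
  have "g (k + int n) = g k" for k
    using per [of k] perD [of k] perw [of "k + 1"] by (simp add: g_def algebra_simps)
  then have "(\<Sum>j<n. g (- 1 + int j)) = (\<Sum>j<n. g (int j))" by (rule sum_periodic_shift)
  moreover have "?t j = g (int j) - g (- 1 + int j) + w (int j) \<bullet> w (int j)" for j
  proof -
    have "w (int j) \<bullet> w (int j) = w (int j) \<bullet> ((norm (D (int j)))\<^sup>2 *\<^sub>R G (x (int j))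
        + (2 * U (x (int j - 1))) *\<^sub>R D (int j - 1) - (2 * U (x (int j))) *\<^sub>R D (int j))"
      by (simp add: w_def)
    then show ?thesis
      by (simp add: g_def inner_add_right inner_diff_right inner_commute algebra_simps)
  qed
  ultimately have "(\<Sum>j<n. w (int j) \<bullet> w (int j)) = 0"
    using zero n by (simp add: sum.distrib sum_subtractf)
  then have "w (int j) = 0" if "j < n" for j
    using that by (simp add: sum_nonneg_eq_0_iff)
  then have "w (i + 1) = 0"
    using periodic_representative [of w n "i + 1"] perw n by metis
  then have "(norm (x (i + 2) - x (i + 1)))\<^sup>2 *\<^sub>R G (x (i + 1)) =
      2 *\<^sub>R (U (x (i + 1)) *\<^sub>R (x (i + 2) - x (i + 1)) - U (x i) *\<^sub>R (x (i + 1) - x i))"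
    by (simp add: w_def D_def algebra_simps)
  then have "(real n / 2) *\<^sub>R ((norm (x (i + 2) - x (i + 1)))\<^sup>2 *\<^sub>R G (x (i + 1))) =
      (real n / 2) *\<^sub>R (2 *\<^sub>R (U (x (i + 1)) *\<^sub>R (x (i + 2) - x (i + 1)) - U (x i) *\<^sub>R (x (i + 1) - x i)))"
    by (simp only:)
  then show ?thesis by (simp add: discrete_momentum_def scaleR_diff_right add.assoc)
qed

section \<open>Bounds independent of the number of vertices\<close>

lemma compact_away_from_Z:
  assumes "r > 0"
  shows "compact {p. r \<le> infdist p Z \<and> norm p \<le> R}" "{p. r \<le> infdist p Z \<and> norm p \<le> R} \<subseteq> - Z"
proof -
  have "closed {p. r \<le> infdist p Z}"
    by (intro closed_Collect_le continuous_intros)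
  then have "compact ({p. r \<le> infdist p Z} \<inter> cball 0 R)" by (intro closed_Int_compact) auto
  then show "compact {p. r \<le> infdist p Z \<and> norm p \<le> R}"
    by (simp add: Int_def)
  show "{p. r \<le> infdist p Z \<and> norm p \<le> R} \<subseteq> - Z" using assms by auto
qed

text \<open>The Euler--Lagrange equation bounds the total variation of the momentum around the loop
  by the action. Some edge has at most the mean size, so the momentum is bounded there and hence
  everywhere. Division by \<open>U \<ge> u0\<close> bounds the difference quotients, and inserting
  these once more into the equation bounds the increments of the momentum by a multiple of
  \<open>1 / n\<close>.\<close>

lemma discrete_extremal_bounds:
  assumes nontrivial: "\<And>a. a \<notin> Z \<Longrightarrow> \<not> homotopic_loops (- Z) \<gamma> (\<lambda>_. a)"
  obtains r R B where "r > 0"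
    "\<And>n x i. minimal_loop \<gamma> n x \<Longrightarrow> action n x \<le> C \<Longrightarrow>
       r \<le> infdist (x i) Z \<and> norm (x i) \<le> R \<and> norm (discrete_momentum n x i) \<le> B \<and>
       real n * norm (x (i + 1) - x i) \<le> B \<and>
       real n * norm (discrete_momentum n x (i + 1) - discrete_momentum n x i) \<le> B"
proof -
  obtain r R where r: "r > 0" and rR: "\<And>n x i. discrete_loop (- Z) \<gamma> n x \<Longrightarrow> action n x \<le> C \<Longrightarrow>
    r \<le> infdist (x i) Z \<and> norm (x i) \<le> R"
    using discrete_loop_compactness [OF nontrivial, of C] by metis
  let ?K = "{p. r \<le> infdist p Z \<and> norm p \<le> R}"
  note K = compact_away_from_Z [OF r, of R]
  have "bounded (G ` ?K)"
    by (intro compact_imp_bounded compact_continuous_image continuous_on_subset [OF G_cont] K)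
  then obtain Gm where Gm: "\<And>p. p \<in> ?K \<Longrightarrow> norm (G p) \<le> Gm"
    unfolding bounded_iff by blast
  have "continuous_on ?K U" using K(2) isCont_U by (intro continuous_at_imp_continuous_on) blast
  then have "bounded (U ` ?K)"
    by (intro compact_imp_bounded compact_continuous_image K)
  then obtain Um where Um: "\<And>p. p \<in> ?K \<Longrightarrow> norm (U p) \<le> Um"
    unfolding bounded_iff by blast
  \<comment> \<open>\<open>E\<close> bounds the sum of \<open>n |D|^2\<close>. In \<open>B1\<close>
    the first summand bounds the momentum at the selected edge and the second its oscillation. The
    absolute values are there because \<open>C\<close>, \<open>Um\<close> and \<open>Gm\<close> are
    bounds of unknown sign.\<close>
  define E where "E = \<bar>C\<bar> / u0"
  define B1 where "B1 = \<bar>Um\<bar> * sqrt E + \<bar>Gm\<bar> / 2 * E"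
  define B2 where "B2 = B1 / u0"
  define B3 where "B3 = \<bar>Gm\<bar> / 2 * B2\<^sup>2"
  have E0: "E \<ge> 0" using u0_pos by (simp add: E_def)
  have bounds: "r \<le> infdist (x i) Z \<and> norm (x i) \<le> R \<and> norm (discrete_momentum n x i) \<le> B1 \<and>
       real n * norm (x (i + 1) - x i) \<le> B2 \<and>
       real n * norm (discrete_momentum n x (i + 1) - discrete_momentum n x i) \<le> B3"
    if minimal: "minimal_loop \<gamma> n x" and C: "action n x \<le> C" for n x i
  proof -
    have loop: "discrete_loop (- Z) \<gamma> n x" using minimal by (simp add: minimal_loop_def)
    define Q where "Q = discrete_momentum n x"
    have Q: "Q i = (real n * U (x i)) *\<^sub>R (x (i + 1) - x i)" for i
      by (simp add: Q_def discrete_momentum_def)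
    have n: "n > 0" and per: "\<And>i. x (i + int n) = x i"
      using loop by (auto simp: discrete_loop_def)
    have xK: "x j \<in> ?K" for j using rR [OF loop C] by blast
    have Z: "x j \<notin> Z" for j using K xK by blast
    define D where "D i = x (i + 1) - x i" for i
    have perD: "D (i + int n) = D i" for i
      using per [of i] per [of "i + 1"] by (simp add: D_def algebra_simps)
    have dQ: "Q (j + 1) - Q j = (real n / 2 * (norm (D (j + 1)))\<^sup>2) *\<^sub>R G (x (j + 1))" for j
      using discrete_euler_lagrange [OF minimal, of j] by (simp add: Q_def D_def add.assoc)
    have ndQ: "norm (Q (j + 1) - Q j) \<le> \<bar>Gm\<bar> / 2 * (real n * (norm (D (j + 1)))\<^sup>2)" for j
    proof -
      have "norm (G (x (j + 1))) \<le> \<bar>Gm\<bar>" using Gm [OF xK [of "j + 1"]] by linarith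
      then have "(real n / 2 * (norm (D (j + 1)))\<^sup>2) * norm (G (x (j + 1))) \<le>
          (real n / 2 * (norm (D (j + 1)))\<^sup>2) * \<bar>Gm\<bar>" by (intro mult_left_mono) auto
      then show ?thesis unfolding dQ by (simp add: mult_ac)
    qed
    have energy: "(\<Sum>l<n. real n * (norm (D (k + int l)))\<^sup>2) \<le> E" for k
    proof -
      define g where "g i = real n * (norm (D i))\<^sup>2" for i
      have "g (i + int n) = g i" for i using perD by (simp add: g_def)
      then have "(\<Sum>l<n. g (k + int l)) = (\<Sum>l<n. g (int l))" by (rule sum_periodic_shift)
      moreover have "u0 * (\<Sum>l<n. g (int l)) \<le> action n x"
        unfolding action_def sum_distrib_left
      proof (rule sum_mono)
        fix l
        have "u0 * (norm (D (int l)))\<^sup>2 \<le> U (x (int l)) * (norm (D (int l)))\<^sup>2"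
          using U_ge [OF Z] by (intro mult_right_mono) auto
        then have "real n * (u0 * (norm (D (int l)))\<^sup>2) \<le> real n * (U (x (int l)) * (norm (D (int l)))\<^sup>2)"
          by (intro mult_left_mono) auto
        then show "u0 * g (int l) \<le> real n * (U (x (int l)) * (norm (x (int l + 1) - x (int l)))\<^sup>2)"
          by (simp add: g_def D_def mult_ac)
      qed
      ultimately have "u0 * (\<Sum>l<n. g (k + int l)) \<le> \<bar>C\<bar>" using C by simp
      then show ?thesis using u0_pos by (simp add: E_def g_def pos_le_divide_eq mult.commute)
    qed
    have osc: "norm (Q (j + int k) - Q j) \<le> \<bar>Gm\<bar> / 2 * E" if "k \<le> n" for j k
    proof -
      have "norm (Q (j + int k) - Q j) \<le> (\<Sum>l<k. norm (Q (j + int l + 1) - Q (j + int l)))"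
        by (rule norm_diff_le_sum)
      also have "\<dots> \<le> (\<Sum>l<k. \<bar>Gm\<bar> / 2 * (real n * (norm (D (j + 1 + int l)))\<^sup>2))"
        using ndQ by (intro sum_mono) (metis add.commute add.left_commute)
      also have "\<dots> \<le> (\<Sum>l<n. \<bar>Gm\<bar> / 2 * (real n * (norm (D (j + 1 + int l)))\<^sup>2))"
        using that by (intro sum_mono2) auto
      also have "\<dots> \<le> \<bar>Gm\<bar> / 2 * E"
        by (subst sum_distrib_left [symmetric]) (intro mult_left_mono energy, auto)
      finally show ?thesis .
    qed
    \<comment> \<open>The mean over the \<open>n\<close> edges of \<open>(n |D|)^2\<close> equals
      the sum of \<open>n |D|^2\<close>, so not all of these squares can exceed
      \<open>E\<close>.\<close>
    have "\<exists>j<n. (real n * norm (D (int j)))\<^sup>2 \<le> E"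
    proof (rule ccontr)
      assume "\<not> ?thesis"
      then have "E < (real n * norm (D (int j)))\<^sup>2" if "j < n" for j using that by (meson not_le)
      then have "(\<Sum>j<n. E) < (\<Sum>j<n. (real n * norm (D (int j)))\<^sup>2)"
        using n by (intro sum_strict_mono) auto
      also have "\<dots> = real n * (\<Sum>l<n. real n * (norm (D (0 + int l)))\<^sup>2)"
        by (simp add: sum_distrib_left power_mult_distrib power2_eq_square mult_ac)
      also have "\<dots> \<le> real n * E" by (intro mult_left_mono energy) auto
      finally show False by simp
    qed
    then obtain j where "(real n * norm (D (int j)))\<^sup>2 \<le> E" by blast
    then have nD: "real n * norm (D (int j)) \<le> sqrt E" by (rule real_le_rsqrt)
    have Qj: "norm (Q (int j)) \<le> \<bar>Um\<bar> * sqrt E"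
    proof -
      have "\<bar>U (x (int j))\<bar> \<le> \<bar>Um\<bar>" using Um [OF xK [of "int j"]] by simp
      then have "\<bar>U (x (int j))\<bar> * (real n * norm (D (int j))) \<le> \<bar>Um\<bar> * sqrt E"
        using nD by (intro mult_mono) auto
      then show ?thesis by (simp add: Q D_def abs_mult mult_ac)
    qed
    have QB: "norm (Q i) \<le> B1" for i
    proof -
      have "\<exists>l<n. Q (int j + int l) = Q (int j + (i - int j))"
      proof (rule periodic_representative)
        fix l
        show "Q (int j + (l + int n)) = Q (int j + l)"
          using per [of "int j + l"] per [of "int j + l + 1"] unfolding Q by (simp add: algebra_simps)
      qed (rule n)
      then obtain l where l: "l < n" "Q (int j + int l) = Q i" by auto
      then show ?thesis
        using osc [of l "int j"] Qj norm_triangle_ineq2 [of "Q i" "Q (int j)"] by (simp add: B1_def)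
    qed
    have DB: "real n * norm (D i) \<le> B2" for i
    proof -
      have "u0 * (real n * norm (D i)) \<le> U (x i) * (real n * norm (D i))"
        using U_ge [OF Z] by (intro mult_right_mono) auto
      also have "\<dots> = norm (Q i)" using U_pos [OF Z [of i]] by (simp add: Q D_def abs_mult mult_ac)
      finally show ?thesis using QB [of i] u0_pos by (simp add: B2_def pos_le_divide_eq mult.commute)
    qed
    have "real n * norm (Q (i + 1) - Q i) \<le> real n * (\<bar>Gm\<bar> / 2 * (real n * (norm (D (i + 1)))\<^sup>2))"
      by (intro mult_left_mono ndQ) auto
    also have "\<dots> = \<bar>Gm\<bar> / 2 * (real n * norm (D (i + 1)))\<^sup>2"
      by (simp add: power_mult_distrib power2_eq_square mult_ac)
    also have "\<dots> \<le> B3"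
      unfolding B3_def by (intro mult_left_mono power_mono DB) auto
    finally show ?thesis using xK QB DB by (simp add: D_def Q_def)
  qed
  show thesis
  proof (rule that [OF r])
    fix n x i
    assume "minimal_loop \<gamma> n x" "action n x \<le> C"
    from bounds [OF this, of i]
    show "r \<le> infdist (x i) Z \<and> norm (x i) \<le> R \<and> norm (discrete_momentum n x i) \<le> max B1 (max B2 B3) \<and>
       real n * norm (x (i + 1) - x i) \<le> max B1 (max B2 B3) \<and>
       real n * norm (discrete_momentum n x (i + 1) - discrete_momentum n x i) \<le> max B1 (max B2 B3)"
      by (simp add: le_max_iff_disj)
  qed
qed

section \<open>Competitors of bounded action\<close>

text \<open>Polygons inscribed in a merely continuous loop may have unbounded action as
  \<open>n\<close> grows. A polynomial loop with the same end points, closer to \<gamma> than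
  \<gamma> is to \<open>Z\<close>, is homotopic to it and Lipschitz.\<close>

lemma smooth_loop_representative:
  assumes \<gamma>: "path \<gamma>" "path_image \<gamma> \<subseteq> - Z" "pathfinish \<gamma> = pathstart \<gamma>"
  obtains p L where "path p" "path_image p \<subseteq> - Z" "p 1 = p 0" "homotopic_loops (- Z) p \<gamma>"
    "\<And>s t. s \<in> {0..1} \<Longrightarrow> t \<in> {0..1} \<Longrightarrow> norm (p s - p t) \<le> L * \<bar>s - t\<bar>"
proof -
  have "path_image \<gamma> \<inter> Z = {}" using \<gamma>(2) by blast
  then obtain d where d: "d > 0" "\<And>p z. p \<in> path_image \<gamma> \<Longrightarrow> z \<in> Z \<Longrightarrow> d \<le> dist p z"
    using separate_compact_closed [OF compact_path_image [OF \<gamma>(1)] compact_imp_closed [OF compact_Z]]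
    by blast
  obtain p where p: "polynomial_function p" "pathstart p = pathstart \<gamma>" "pathfinish p = pathfinish \<gamma>"
    "\<And>t. t \<in> {0..1} \<Longrightarrow> norm (p t - \<gamma> t) < d"
    using path_approx_polynomial_function [OF \<gamma>(1) d(1)] by blast
  have pathp: "path p" using p(1) by (rule path_polynomial_function)
  have closed: "pathfinish p = pathstart p" using p \<gamma>(3) by simp
  have "homotopic_loops (- Z) \<gamma> p"
  proof (rule homotopic_loops_nearby_explicit [OF \<gamma>(1) pathp \<gamma>(3) closed])
    fix t z assume "t \<in> {0..1::real}" "z \<notin> - Z"
    then show "norm (p t - \<gamma> t) < norm (\<gamma> t - z)"
      using p(4) [of t] d(2) [of "\<gamma> t" z] by (auto simp: path_image_def dist_norm)
  qed
  then have hom: "homotopic_loops (- Z) p \<gamma>" by (rule homotopic_loops_sym)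
  obtain p' where p': "polynomial_function p'" "\<And>t. (p has_vector_derivative p' t) (at t)"
    using has_vector_derivative_polynomial_function [OF p(1)] by blast
  have "bounded (p' ` {0..1})"
    by (intro compact_imp_bounded compact_continuous_image continuous_on_polymonial_function p') auto
  then obtain L where L: "\<And>t. t \<in> {0..1} \<Longrightarrow> norm (p' t) \<le> L"
    unfolding bounded_iff by blast
  have lip: "norm (p s - p t) \<le> L * \<bar>s - t\<bar>" if "s \<in> {0..1}" "t \<in> {0..1}" for s t
  proof -
    have "norm (p s - p t) \<le> L * norm (s - t)"
    proof (rule differentiable_bound [of "{0..1}" p "\<lambda>x h. h *\<^sub>R p' x"])
      show "(p has_derivative (\<lambda>h. h *\<^sub>R p' x)) (at x within {0..1})" for x
        using p'(2) [of x] has_derivative_at_withinI unfolding has_vector_derivative_def by blast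
      show "onorm (\<lambda>h. h *\<^sub>R p' x) \<le> L" if "x \<in> {0..1}" for x
        using mult_left_mono [OF L [OF that] abs_ge_zero] by (intro onorm_le) (simp add: mult.commute)
    qed (use that in auto)
    then show ?thesis by simp
  qed
  have "path_image p \<subseteq> - Z" using homotopic_loops_imp_subset [OF hom] by blast
  moreover have "p 1 = p 0" using closed by (simp add: pathfinish_def pathstart_def)
  ultimately show thesis using that pathp hom lip by blast
qed

text \<open>Inscribed polygons: each edge is at most \<open>L / n\<close> long, so the two factors
  \<open>n\<close> in the action cancel and the bound \<open>Um * L^2\<close> is the same for all
  \<open>n\<close>.\<close>

lemma discrete_loop_of_bounded_action:
  assumes \<gamma>: "path \<gamma>" "path_image \<gamma> \<subseteq> - Z" "pathfinish \<gamma> = pathstart \<gamma>"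
  obtains C n1 where "\<And>n. n \<ge> n1 \<Longrightarrow> \<exists>x. discrete_loop (- Z) \<gamma> n x \<and> action n x \<le> C"
proof -
  obtain p L where p: "path p" "path_image p \<subseteq> - Z" "p 1 = p 0" and hom: "homotopic_loops (- Z) p \<gamma>"
    and lip: "\<And>s t. s \<in> {0..1} \<Longrightarrow> t \<in> {0..1} \<Longrightarrow> norm (p s - p t) \<le> L * \<bar>s - t\<bar>"
    using smooth_loop_representative [OF \<gamma>] by metis
  have L0: "L \<ge> 0" using lip [of 0 1] norm_ge_zero [of "p 0 - p 1"] by (simp del: norm_ge_zero)
  have "path_image p \<inter> Z = {}" using p(2) by blast
  then obtain d where d: "d > 0" "\<And>q z. q \<in> path_image p \<Longrightarrow> z \<in> Z \<Longrightarrow> d \<le> dist q z"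
    using separate_compact_closed [OF compact_path_image [OF p(1)] compact_imp_closed [OF compact_Z]]
    by blast
  have "continuous_on (path_image p) U"
    using p(2) isCont_U by (intro continuous_at_imp_continuous_on) blast
  then have "bounded (U ` path_image p)"
    by (intro compact_imp_bounded compact_continuous_image compact_path_image p)
  then obtain Um where Um: "\<And>q. q \<in> path_image p \<Longrightarrow> norm (U q) \<le> Um"
    unfolding bounded_iff by blast
  \<comment> \<open>Beyond this threshold \<open>L / n < d\<close>, so the inscribed polygon is
    closer to \<open>p\<close> than \<open>p\<close> is to \<open>Z\<close>.\<close>
  obtain n1 where n1: "real n1 > L / d" using reals_Archimedean2 by blast
  have "\<exists>x. discrete_loop (- Z) \<gamma> n x \<and> action n x \<le> Um * L\<^sup>2" if "n \<ge> Suc n1" for n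
  proof -
    have n: "n > 0" using that by simp
    \<comment> \<open>\<open>frac\<close> extends the samples periodically to all integers;
      \<open>p 1 = p 0\<close> makes the sample with index \<open>n\<close> the right one.\<close>
    define x where "x i = p (frac (real_of_int i / real n))" for i
    have per: "x (i + int n) = x i" for i
    proof -
      have "real_of_int (i + int n) / real n = real_of_int i / real n + 1"
        using n by (simp add: field_simps)
      then show ?thesis unfolding x_def by (simp only: frac_1_eq)
    qed
    have grid: "x (int j) = p (real j / real n)" if "j \<le> n" for j
    proof (cases "j = n")
      case True
      then show ?thesis using n p(3) by (simp add: x_def)
    next
      case False
      then have "frac (real j / real n) = real j / real n" using that n by (simp add: frac_eq)
      then show ?thesis by (simp add: x_def)
    qed
    have xin: "x i \<in> path_image p" for i
      unfolding x_def path_image_def using frac_lt_1 [of "real_of_int i / real n"] by (intro imageI) (auto intro: less_imp_le)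
    have step: "norm (x (int j + 1) - x (int j)) \<le> L / real n" if "j < n" for j
    proof -
      have "x (int j + 1) = p (real (Suc j) / real n)" "x (int j) = p (real j / real n)"
        using grid [of "Suc j"] grid [of j] that by (simp_all add: add.commute)
      moreover have "norm (p (real (Suc j) / real n) - p (real j / real n)) \<le> L * \<bar>real (Suc j) / real n - real j / real n\<bar>"
        using that by (intro lip) auto
      moreover have "real (Suc j) / real n - real j / real n = 1 / real n"
        by (simp add: diff_divide_distrib [symmetric])
      ultimately show ?thesis by simp
    qed
    \<comment> \<open>At \<open>t = 1\<close> the index \<open>j\<close> would be \<open>n\<close>
      and the next node would lie beyond the parameter interval of \<open>p\<close>; hence the
      separate case.\<close>
    have near: "norm (polygon n x t - p t) \<le> L / real n" if t: "t \<in> {0..1}" for t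
    proof (cases "t = 1")
      case True
      then show ?thesis using grid [of n] n L0 by (simp add: polygon_def)
    next
      case False
      define j where "j = nat \<lfloor>real n * t\<rfloor>"
      have "real n * t < real n" "0 \<le> real n * t" using False t n by auto
      then have fl: "\<lfloor>real n * t\<rfloor> = int j" and j: "j < n" "real j \<le> real n * t" "real n * t < real j + 1"
        unfolding j_def by linarith+
      have dist: "norm (p (real k / real n) - p t) \<le> L / real n" if k: "k = j \<or> k = Suc j" for k
      proof -
        have "norm (p (real k / real n) - p t) \<le> L * \<bar>real k / real n - t\<bar>"
          using k j t n by (intro lip) auto
        also have "\<bar>real k / real n - t\<bar> = \<bar>real k - real n * t\<bar> / real n"
        proof -
          have "real k / real n - t = (real k - real n * t) / real n" using n by (simp add: field_simps)
          then show ?thesis by simp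
        qed
        also have "L * \<dots> \<le> L * (1 / real n)"
          using k j L0 by (intro mult_left_mono divide_right_mono) auto
        finally show ?thesis by simp
      qed
      have "norm (interp (\<lambda>i. x i - p t) (real n * t)) \<le> L / real n"
      proof (rule norm_interp_le)
        show "norm (x \<lfloor>real n * t\<rfloor> - p t) \<le> L / real n"
          using dist [of j] grid [of j] j fl by simp
        have "int j + 1 = int (Suc j)" by simp
        then show "norm (x (\<lfloor>real n * t\<rfloor> + 1) - p t) \<le> L / real n"
          using dist [of "Suc j"] grid [of "Suc j"] j(1) fl by (metis Suc_leI)
      qed
      moreover have "interp (\<lambda>i. x i - p t) (real n * t) = polygon n x t - p t"
        by (simp add: interp_def polygon_def algebra_simps)
      ultimately show ?thesis by simp
    qed
    have "L / real n < d"
    proof -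
      have "L / d < real n" using n1 that by simp
      then show ?thesis using d(1) n by (simp add: field_simps)
    qed
    have "homotopic_loops (- Z) p (polygon n x)"
    proof (rule homotopic_loops_nearby_explicit)
      show "path p" by fact
      show "path (polygon n x)" using per n by (rule path_polygon)
      show "pathfinish (polygon n x) = pathstart (polygon n x)" using per by (rule polygon_closed)
      show "pathfinish p = pathstart p" using p(3) by (simp add: pathfinish_def pathstart_def)
      fix t z assume "t \<in> {0..1::real}" "z \<notin> - Z"
      then show "norm (polygon n x t - p t) < norm (p t - z)"
        using near [of t] \<open>L / real n < d\<close> d(2) [of "p t" z] by (auto simp: path_image_def dist_norm)
    qed
    then have "discrete_loop (- Z) \<gamma> n x"
      using hom n homotopic_loops_trans [OF homotopic_loops_sym] by (simp add: discrete_loop_def per) blast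
    moreover have "action n x \<le> Um * L\<^sup>2"
    proof -
      have "(\<Sum>j<n. U (x (int j)) * (norm (x (int j + 1) - x (int j)))\<^sup>2) \<le> (\<Sum>j<n. Um * (L / real n)\<^sup>2)"
      proof (rule sum_mono)
        fix j assume "j \<in> {..<n}"
        moreover have "0 < U (x (int j))" using xin p(2) by (intro U_pos) blast
        ultimately show "U (x (int j)) * (norm (x (int j + 1) - x (int j)))\<^sup>2 \<le> Um * (L / real n)\<^sup>2"
          using step [of j] Um [OF xin, of "int j"] by (intro mult_mono power_mono) auto
      qed
      then have "action n x \<le> real n * (\<Sum>j<n. Um * (L / real n)\<^sup>2)"
        unfolding action_def by (intro mult_left_mono) auto
      also have "\<dots> = Um * L\<^sup>2" using n by (simp add: power2_eq_square)
      finally show ?thesis .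
    qed
    ultimately show ?thesis by blast
  qed
  then show thesis using that by blast
qed

end

section \<open>Passage to the limit\<close>

lemma polygon_frac:
  assumes "\<And>i. x (i + int n) = x i"
  shows "polygon n x (frac s) = polygon n x s"
proof -
  have "x (i + \<lfloor>s\<rfloor> * int n) = x i" for i using assms by (rule periodic_mult)
  from interp_periodic [of x, OF this, of "real n * frac s"] show ?thesis
    by (simp add: polygon_def frac_def algebra_simps)
qed

lemma polygon_lipschitz:
  fixes x :: "int \<Rightarrow> 'a::real_normed_vector"
  assumes "\<And>i. real n * norm (x (i + 1) - x i) \<le> L" and n: "n > 0"
  shows "norm (polygon n x s - polygon n x t) \<le> L * \<bar>s - t\<bar>"
proof -
  have "norm (x (i + 1) - x i) \<le> L / real n" for i
    using assms(1) [of i] n by (simp add: pos_le_divide_eq mult.commute)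
  then have "norm (interp x (real n * s) - interp x (real n * t)) \<le> L / real n * \<bar>real n * s - real n * t\<bar>"
    by (rule interp_lipschitz)
  also have "\<dots> = L * \<bar>s - t\<bar>"
    using n by (simp add: right_diff_distrib [symmetric] abs_mult del: right_diff_distrib)
  finally show ?thesis by (simp add: polygon_def)
qed

context singular_conformal_factor
begin

text \<open>The Hamiltonian vector field of \<open>|p|^2 / (2 U)\<close>, that is, the geodesic
  equation of the metric \<open>U |dx|^2\<close> in first-order form.\<close>

definition flow :: "'a \<times> 'a \<Rightarrow> 'a \<times> 'a" where
  "flow y = ((1 / U (fst y)) *\<^sub>R snd y, ((norm (snd y))\<^sup>2 / (2 * (U (fst y))\<^sup>2)) *\<^sub>R G (fst y))"

lemma continuous_on_flow:
  assumes "fst ` T \<subseteq> - Z"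
  shows "continuous_on T flow"
proof -
  have "continuous_on (- Z) U" using isCont_U by (simp add: continuous_at_imp_continuous_on)
  then have 1: "continuous_on T (\<lambda>y. U (fst y))"
    by (rule continuous_on_compose2) (use assms in \<open>auto intro!: continuous_intros\<close>)
  have 2: "continuous_on T (\<lambda>y. G (fst y))"
    by (rule continuous_on_compose2 [OF G_cont]) (use assms in \<open>auto intro!: continuous_intros\<close>)
  have "U (fst y) \<noteq> 0" if "y \<in> T" for y
    using U_pos [of "fst y"] assms that by force
  then show ?thesis unfolding flow_def by (intro continuous_intros 1 2) auto
qed

text \<open>Positions and momenta are interpolated together as one polygon in phase space. A single
  use of Arzela--Ascoli then gives both limits, and the equation becomes first order with a
  continuous right-hand side, which is what \<open>discrete_limit_derivative\<close> asks
  for.\<close>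

theorem closed_extremal_exists:
  assumes \<gamma>: "path \<gamma>" "path_image \<gamma> \<subseteq> - Z" "pathfinish \<gamma> = pathstart \<gamma>"
    and nontrivial: "\<And>a. a \<notin> Z \<Longrightarrow> \<not> homotopic_loops (- Z) \<gamma> (\<lambda>_. a)"
  obtains x p where "\<And>s. x s \<notin> Z" "\<And>s. x (s + 1) = x s" "homotopic_loops (- Z) x \<gamma>"
    "\<And>s. (x has_vector_derivative (1 / U (x s)) *\<^sub>R p s) (at s)"
    "\<And>s. (p has_vector_derivative ((norm (p s))\<^sup>2 / (2 * (U (x s))\<^sup>2)) *\<^sub>R G (x s)) (at s)"
proof -
  obtain C n1 where start: "\<And>n. n \<ge> n1 \<Longrightarrow> \<exists>x. discrete_loop (- Z) \<gamma> n x \<and> action n x \<le> C"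
    using discrete_loop_of_bounded_action [OF \<gamma>] by metis
  obtain n0 where n0: "n0 > 0" and edges: "\<And>n x i. n \<ge> n0 \<Longrightarrow> \<forall>i. x (i + int n) = x i \<Longrightarrow> \<forall>i. x i \<notin> Z \<Longrightarrow>
     action n x \<le> C \<Longrightarrow> norm (x (i + 1) - x i) < infdist (x i) Z"
    using edge_small [of C] by metis
  obtain r R B where r: "r > 0" and bounds0: "\<And>n x i. minimal_loop \<gamma> n x \<Longrightarrow> action n x \<le> C \<Longrightarrow>
       r \<le> infdist (x i) Z \<and> norm (x i) \<le> R \<and> norm (discrete_momentum n x i) \<le> B \<and>
       real n * norm (x (i + 1) - x i) \<le> B \<and>
       real n * norm (discrete_momentum n x (i + 1) - discrete_momentum n x i) \<le> B"
    using discrete_extremal_bounds [OF nontrivial, of C] by metis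
  \<comment> \<open>Every \<open>N k\<close> lies above both thresholds, and
    \<open>N k \<ge> k\<close> sends it to infinity along any subsequence.\<close>
  define N where "N k = n0 + n1 + k" for k
  have Npos: "N k > 0" for k using n0 by (simp add: N_def)
  have "\<exists>x. minimal_loop \<gamma> (N k) x \<and> action (N k) x \<le> C" for k
  proof -
    have "n0 \<le> N k" "n1 \<le> N k" by (simp_all add: N_def)
    then obtain x0 where x0: "discrete_loop (- Z) \<gamma> (N k) x0" "action (N k) x0 \<le> C"
      using start by blast
    show ?thesis
    proof (rule discrete_minimiser [OF _ _ x0])
      show "\<not> homotopic_loops (- Z) \<gamma> (\<lambda>_. a)" if "a \<notin> Z" for a using that by (rule nontrivial)
      show "norm (x (i + 1) - x i) < infdist (x i) Z"
        if "\<forall>i. x (i + int (N k)) = x i" "\<forall>i. x i \<notin> Z" "action (N k) x \<le> C" for x i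
        using \<open>n0 \<le> N k\<close> that by (rule edges)
    qed blast
  qed
  then obtain X where minimal: "\<And>k. minimal_loop \<gamma> (N k) (X k)" and act: "\<And>k. action (N k) (X k) \<le> C"
    by metis
  have loop: "discrete_loop (- Z) \<gamma> (N k) (X k)" for k
    using minimal by (simp add: minimal_loop_def)
  define Q where "Q k = discrete_momentum (N k) (X k)" for k
  have Q: "Q k i = (real (N k) * U (X k i)) *\<^sub>R (X k (i + 1) - X k i)" for k i
    by (simp add: Q_def discrete_momentum_def)
  have bounds: "r \<le> infdist (X k i) Z \<and> norm (X k i) \<le> R \<and> norm (Q k i) \<le> B \<and>
       real (N k) * norm (X k (i + 1) - X k i) \<le> B \<and> real (N k) * norm (Q k (i + 1) - Q k i) \<le> B" for k i
    unfolding Q_def by (rule bounds0 [OF minimal act])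
  have XZ: "X k i \<notin> Z" for k i using discrete_loop_vertex [OF loop] by blast
  have perX: "X k (i + int (N k)) = X k i" for k i using loop by (simp add: discrete_loop_def)
  define Y where "Y k i = (X k i, Q k i)" for k i
  have perY: "Y k (i + int (N k)) = Y k i" for k i
    using perX [of k i] perX [of k "i + 1"] by (simp add: Y_def Q algebra_simps)
  define KK where "KK = {p. r \<le> infdist p Z \<and> norm p \<le> R} \<times> cball (0::'a) B"
  have KK: "compact KK" "fst ` KK \<subseteq> - Z"
    using compact_away_from_Z [OF r, of R] unfolding KK_def by (auto intro!: compact_Times)
  have YK: "Y k i \<in> KK" for k i using bounds by (simp add: Y_def KK_def)
  have stepY: "real (N k) * norm (Y k (i + 1) - Y k i) \<le> 2 * B" for k i
  proof -
    have "norm (Y k (i + 1) - Y k i) \<le> norm (X k (i + 1) - X k i) + norm (Q k (i + 1) - Q k i)"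
      by (simp add: Y_def norm_Pair_le)
    then have "real (N k) * norm (Y k (i + 1) - Y k i) \<le>
       real (N k) * (norm (X k (i + 1) - X k i) + norm (Q k (i + 1) - Q k i))"
      by (rule mult_left_mono) simp
    also have "\<dots> \<le> B + B" using bounds [of k i] unfolding distrib_left by (intro add_mono) blast+
    finally show ?thesis by simp
  qed
  define P where "P k = polygon (N k) (Y k)" for k
  have lipP: "norm (P k s - P k t) \<le> 2 * B * \<bar>s - t\<bar>" for k s t
    unfolding P_def by (intro polygon_lipschitz stepY Npos)
  have B0: "B \<ge> 0" using bounds [of 0 0] norm_ge_zero order_trans by blast
  obtain M where M: "\<And>y. y \<in> KK \<Longrightarrow> norm y \<le> M"
    using compact_imp_bounded [OF KK(1)] unfolding bounded_iff by blast
  have boundP: "norm (P k s) \<le> M" for k s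
    unfolding P_def polygon_def by (intro norm_interp_le M YK)
  obtain g q where "continuous_on {0..1::real} g" and q: "strict_mono (q :: nat \<Rightarrow> nat)"
    and g: "\<And>e. 0 < e \<Longrightarrow> \<exists>m. \<forall>k s. k \<ge> m \<and> s \<in> {0..1} \<longrightarrow> norm (P (q k) s - g s) < e"
  proof (rule Arzela_Ascoli [of "{0..1::real}" P M])
    fix s e :: real assume "0 < e"
    show "\<exists>d>0. \<forall>k t. t \<in> {0..1} \<and> norm (s - t) < d \<longrightarrow> norm (P k s - P k t) < e"
    proof (intro exI conjI allI impI)
      show "e / (2 * B + 1) > 0" using \<open>0 < e\<close> B0 by simp
      fix k t assume "t \<in> {0..1} \<and> norm (s - t) < e / (2 * B + 1)"
      then have "(2 * B + 1) * \<bar>s - t\<bar> < e" using B0 by (simp add: pos_less_divide_eq mult.commute)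
      moreover have "2 * B * \<bar>s - t\<bar> \<le> (2 * B + 1) * \<bar>s - t\<bar>" by (intro mult_right_mono) auto
      ultimately show "norm (P k s - P k t) < e" using lipP [of k s t] by linarith
    qed
  qed (use boundP in auto)
  \<comment> \<open>Arzela--Ascoli is applied on \<open>[0, 1]\<close> only; as the polygons are
    periodic, the periodic extension of \<open>g\<close> is their uniform limit on the whole
    line.\<close>
  define y where "y s = g (frac s)" for s
  have unif: "\<forall>\<^sub>F k in sequentially. \<forall>s. norm (P (q k) s - y s) < e" if "e > 0" for e
  proof -
    obtain m where m: "\<And>k s. k \<ge> m \<Longrightarrow> s \<in> {0..1} \<Longrightarrow> norm (P (q k) s - g s) < e"
      using g [OF \<open>e > 0\<close>] by blast
    have "norm (P (q k) s - y s) < e" if "k \<ge> m" for k s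
    proof -
      have "P (q k) (frac s) = P (q k) s" unfolding P_def using perY by (rule polygon_frac)
      then show ?thesis using m [OF that, of "frac s"] frac_lt_1 [of s] by (simp add: y_def less_imp_le)
    qed
    then show ?thesis unfolding eventually_sequentially by blast
  qed
  have lim: "(\<lambda>k. P (q k) s) \<longlonglongrightarrow> y s" for s
  proof (rule tendstoI)
    fix e :: real assume "e > 0"
    from unif [OF this] show "\<forall>\<^sub>F k in sequentially. dist (P (q k) s) (y s) < e"
      by eventually_elim (simp add: dist_norm)
  qed
  have lipy: "norm (y s - y t) \<le> 2 * B * \<bar>s - t\<bar>" for s t
    by (rule Lim_norm_ubound [OF _ tendsto_diff [OF lim lim]]) (use lipP in auto)
  have conty: "continuous_on UNIV y"
  proof -
    have "(2 * B)-lipschitz_on UNIV y"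
      using lipy B0 by (intro lipschitz_onI) (auto simp: dist_norm)
    then show ?thesis by (rule lipschitz_on_continuous_on)
  qed
  have Ninf: "filterlim (\<lambda>k. N (q k)) at_top sequentially"
  proof (rule filterlim_at_top_mono [OF filterlim_subseq [OF q]])
    show "\<forall>\<^sub>F k in sequentially. q k \<le> N (q k)" by (simp add: N_def)
  qed
  have Nlarge: "\<forall>\<^sub>F k in sequentially. c < real (N (q k))" for c
    using filterlim_compose [OF filterlim_real_sequentially Ninf] by (simp add: filterlim_at_top_dense)
  \<comment> \<open>\<open>KK\<close> is not convex in general, so the interpolated points need not
    belong to it. The limit is reached instead through vertices, which do belong to it and are
    within \<open>2 * B / n\<close> of the interpolated points.\<close>
  have yK: "y s \<in> KK" for s
  proof -
    have "(\<lambda>k. Y (q k) \<lfloor>real (N (q k)) * s\<rfloor>) \<longlonglongrightarrow> y s" (is "?v \<longlonglongrightarrow> _")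
    proof (rule Lim_transform [OF lim])
      show "(\<lambda>k. Y (q k) \<lfloor>real (N (q k)) * s\<rfloor> - P (q k) s) \<longlonglongrightarrow> 0"
      proof (rule Lim_null_comparison)
        show "\<forall>\<^sub>F k in sequentially. norm (Y (q k) \<lfloor>real (N (q k)) * s\<rfloor> - P (q k) s) \<le> 2 * B * (1 / real (N (q k)))"
        proof (rule always_eventually, rule allI)
          fix k
          let ?n = "real (N (q k))"
          have n: "?n > 0" using Npos by simp
          have "Y (q k) \<lfloor>?n * s\<rfloor> = P (q k) (of_int \<lfloor>?n * s\<rfloor> / ?n)"
            using n by (simp add: P_def polygon_def)
          then have "norm (Y (q k) \<lfloor>?n * s\<rfloor> - P (q k) s) \<le> 2 * B * \<bar>of_int \<lfloor>?n * s\<rfloor> / ?n - s\<bar>"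
            using lipP by simp
          also have "of_int \<lfloor>?n * s\<rfloor> / ?n - s = (of_int \<lfloor>?n * s\<rfloor> - ?n * s) / ?n"
            using n by (simp add: field_simps)
          also have "2 * B * \<bar>(of_int \<lfloor>?n * s\<rfloor> - ?n * s) / ?n\<bar> \<le> 2 * B * (1 / ?n)"
          proof -
            have "\<bar>of_int \<lfloor>?n * s\<rfloor> - ?n * s\<bar> \<le> 1" by linarith
            then have "2 * B * (\<bar>of_int \<lfloor>?n * s\<rfloor> - ?n * s\<bar> / ?n) \<le> 2 * B * (1 / ?n)"
              using n B0 by (intro mult_left_mono divide_right_mono) auto
            then show ?thesis by simp
          qed
          finally show "norm (Y (q k) \<lfloor>?n * s\<rfloor> - P (q k) s) \<le> 2 * B * (1 / ?n)" .
        qed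
        have "(\<lambda>k. 1 / real (N (q k))) \<longlonglongrightarrow> 0"
          using filterlim_compose [OF lim_1_over_n Ninf] by simp
        then show "(\<lambda>k. 2 * B * (1 / real (N (q k)))) \<longlonglongrightarrow> 0"
          by (rule tendsto_mult_right_zero)
      qed
    qed
    with compact_imp_closed [OF KK(1)] YK show ?thesis
      using closed_sequentially [of KK ?v "y s"] by blast
  qed
  have "uniformly_continuous_on KK flow"
    using compact_uniformly_continuous continuous_on_flow KK by blast
  then have uc: "\<exists>d>0. \<forall>a\<in>KK. \<forall>b\<in>KK. dist a b < d \<longrightarrow> dist (flow a) (flow b) < e" if "e > 0" for e
    using that unfolding uniformly_continuous_on_def by (simp add: dist_commute)
  \<comment> \<open>The discrete equations are the symplectic Euler method for \<open>flow\<close>: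
    the position advances with the old state, the momentum with the new one.\<close>
  have scheme: "real (N k) *\<^sub>R (Y k (i + 1) - Y k i) = (fst (flow (Y k i)), snd (flow (Y k (i + 1))))" for k i
  proof (rule prod_eqI)
    have U: "U (X k j) > 0" for j using U_pos [OF XZ] .
    show "fst (real (N k) *\<^sub>R (Y k (i + 1) - Y k i)) = fst (fst (flow (Y k i)), snd (flow (Y k (i + 1))))"
      using U [of i] by (simp add: Y_def flow_def Q)
    let ?D = "X k (i + 2) - X k (i + 1)"
    have dQ: "Q k (i + 1) - Q k i = (real (N k) / 2 * (norm ?D)\<^sup>2) *\<^sub>R G (X k (i + 1))"
      unfolding Q_def by (rule discrete_euler_lagrange [OF minimal])
    have "(norm (Q k (i + 1)))\<^sup>2 / (2 * (U (X k (i + 1)))\<^sup>2) = (real (N k))\<^sup>2 / 2 * (norm ?D)\<^sup>2"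
      using U [of "i + 1"] by (simp add: Q power_mult_distrib add.assoc)
    then show "snd (real (N k) *\<^sub>R (Y k (i + 1) - Y k i)) = snd (fst (flow (Y k i)), snd (flow (Y k (i + 1))))"
      by (simp add: Y_def flow_def dQ power2_eq_square)
  qed
  have deriv: "(y has_vector_derivative flow (y s)) (at s)" for s
  proof (rule discrete_limit_derivative [OF Ninf, of "\<lambda>k. Y (q k)" y "\<lambda>s. flow (y s)"])
    show "(\<lambda>k. polygon (N (q k)) (Y (q k)) s) \<longlonglongrightarrow> y s" for s
      using lim by (simp add: P_def)
    have "continuous_on UNIV (\<lambda>s. flow (y s))"
      by (rule continuous_on_compose2 [OF continuous_on_flow conty]) (use KK yK in auto)
    then show "isCont (\<lambda>s. flow (y s)) s" by (simp add: continuous_on_eq_continuous_at)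
    fix e :: real assume e: "e > 0"
    \<comment> \<open>One half of \<open>d\<close> is spent on the distance between polygon and
      limit, the other on a single step of the scheme, which also evaluates \<open>flow\<close> at
      the next vertex.\<close>
    obtain d where d: "d > 0" "\<And>a b. a \<in> KK \<Longrightarrow> b \<in> KK \<Longrightarrow> dist a b < d \<Longrightarrow> dist (flow a) (flow b) < e / 2"
      using uc [of "e / 2"] e by auto
    have "\<forall>\<^sub>F k in sequentially. \<forall>s. norm (P (q k) s - y s) < d / 2" by (rule unif) (use d(1) in simp)
    moreover have "\<forall>\<^sub>F k in sequentially. 2 * B / (d / 2) < real (N (q k))" by (rule Nlarge)
    ultimately show "\<forall>\<^sub>F k in sequentially. \<forall>i.
        norm (real (N (q k)) *\<^sub>R (Y (q k) (i + 1) - Y (q k) i) - flow (y (of_int i / real (N (q k))))) \<le> e"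
    proof eventually_elim
      case (elim k)
      let ?n = "real (N (q k))"
      have n: "?n > 0" using Npos by simp
      show ?case
      proof
        fix i
        let ?s = "of_int i / ?n"
        have "P (q k) ?s = Y (q k) i" using n by (simp add: P_def polygon_def)
        then have 1: "dist (Y (q k) i) (y ?s) < d / 2" using elim(1) by (metis dist_norm)
        have "norm (Y (q k) (i + 1) - Y (q k) i) * ?n \<le> 2 * B" using stepY by (simp add: mult.commute)
        also have "2 * B < d / 2 * ?n" using elim(2) d(1) by (simp add: pos_divide_less_eq mult.commute)
        finally have 2: "dist (Y (q k) (i + 1)) (Y (q k) i) < d / 2" using n by (simp add: dist_norm)
        have 3: "dist (Y (q k) (i + 1)) (y ?s) < d" "dist (Y (q k) i) (y ?s) < d"
          using 1 2 d(1) dist_triangle [of "Y (q k) (i + 1)" "y ?s" "Y (q k) i"] by linarith+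
        have "dist (fst (flow (Y (q k) i))) (fst (flow (y ?s))) \<le> e / 2"
          "dist (snd (flow (Y (q k) (i + 1)))) (snd (flow (y ?s))) \<le> e / 2"
          using d(2) [OF YK yK 3(1)] d(2) [OF YK yK 3(2)]
            dist_fst_le order_trans less_imp_le dist_snd_le by metis+
        then have "norm (fst (flow (Y (q k) i)) - fst (flow (y ?s)),
            snd (flow (Y (q k) (i + 1))) - snd (flow (y ?s))) \<le> e / 2 + e / 2"
          unfolding dist_norm by (intro order_trans [OF norm_Pair_le] add_mono)
        then show "norm (?n *\<^sub>R (Y (q k) (i + 1) - Y (q k) i) - flow (y ?s)) \<le> e"
          unfolding scheme by (metis diff_Pair field_sum_of_halves prod.collapse)
      qed
    qed
  qed
  have hom: "homotopic_loops (- Z) (\<lambda>s. fst (y s)) \<gamma>"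
  proof -
    \<comment> \<open>The limit keeps distance at least \<open>r\<close> from \<open>Z\<close>, so
      one polygon uniformly closer than \<open>r\<close> already shares its class.\<close>
    obtain k where k: "\<And>s. norm (P (q k) s - y s) < r"
      using eventually_happens [OF unif [OF r]] by auto
    have fstP: "fst (P (q k) s) = polygon (N (q k)) (X (q k)) s" for s
      by (simp add: P_def polygon_def interp_def Y_def)
    have "homotopic_loops (- Z) (\<lambda>s. fst (y s)) (polygon (N (q k)) (X (q k)))"
    proof (rule homotopic_loops_nearby_explicit)
      show "path (\<lambda>s. fst (y s))"
        unfolding path_def by (intro continuous_intros continuous_on_subset [OF conty]) auto
      show "path (polygon (N (q k)) (X (q k)))" using perX Npos by (rule path_polygon)
      show "pathfinish (\<lambda>s. fst (y s)) = pathstart (\<lambda>s. fst (y s))"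
        by (simp add: pathfinish_def pathstart_def y_def)
      show "pathfinish (polygon (N (q k)) (X (q k))) = pathstart (polygon (N (q k)) (X (q k)))"
        using perX by (rule polygon_closed)
      fix s z assume "z \<notin> - Z"
      have "norm (polygon (N (q k)) (X (q k)) s - fst (y s)) \<le> norm (P (q k) s - y s)"
        using norm_fst_le [of "fst (P (q k) s - y s)" "snd (P (q k) s - y s)"] by (simp only: prod.collapse) (simp add: fstP)
      also have "\<dots> < r" by (rule k)
      also have "r \<le> infdist (fst (y s)) Z" using yK [of s] by (auto simp: KK_def)
      also have "\<dots> \<le> norm (fst (y s) - z)"
        using infdist_le [of z Z "fst (y s)"] \<open>z \<notin> - Z\<close> by (simp add: dist_norm)
      finally show "norm (polygon (N (q k)) (X (q k)) s - fst (y s)) < norm (fst (y s) - z)" .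
    qed
    moreover have "homotopic_loops (- Z) (polygon (N (q k)) (X (q k))) \<gamma>"
      using loop by (simp add: discrete_loop_def)
    ultimately show ?thesis by (rule homotopic_loops_trans)
  qed
  show thesis
  proof (rule that [of "\<lambda>s. fst (y s)" "\<lambda>s. snd (y s)"])
    show "fst (y s) \<notin> Z" for s using yK [of s] KK(2) by blast
    show "fst (y (s + 1)) = fst (y s)" for s by (simp add: y_def frac_1_eq)
    show "((\<lambda>s. fst (y s)) has_vector_derivative (1 / U (fst (y s))) *\<^sub>R snd (y s)) (at s)" for s
      using bounded_linear.has_vector_derivative [OF bounded_linear_fst deriv [of s]] by (simp add: flow_def)
    show "((\<lambda>s. snd (y s)) has_vector_derivative
        ((norm (snd (y s)))\<^sup>2 / (2 * (U (fst (y s)))\<^sup>2)) *\<^sub>R G (fst (y s))) (at s)" for s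
      using bounded_linear.has_vector_derivative [OF bounded_linear_snd deriv [of s]] by (simp add: flow_def)
  qed (rule hom)
qed

end

section \<open>Change of time\<close>

text \<open>Separation of variables: the antiderivative \<open>\<tau>\<close> of
  \<open>1 / g\<close> is time as a function of the parameter, and \<open>\<theta>\<close> is its
  inverse. Periodicity of \<open>g\<close> makes \<open>\<tau>\<close> grow by the same
  \<open>T > 0\<close> on each unit interval, so it maps onto the whole line and
  \<open>\<theta>\<close> is defined for all times.\<close>

lemma periodic_time_change:
  fixes g :: "real \<Rightarrow> real"
  assumes cont: "continuous_on UNIV g" and pos: "\<And>s. g s > 0" and per: "\<And>s. g (s + 1) = g s"
  obtains \<theta> T where "T > 0" "\<theta> 0 = 0" "\<And>t. \<theta> (t + T) = \<theta> t + 1"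
    "\<And>t. (\<theta> has_real_derivative g (\<theta> t)) (at t)"
proof -
  have contg: "isCont g s" for s using cont by (simp add: continuous_on_eq_continuous_at)
  have "\<exists>F. \<forall>s. -\<infinity> < ereal s \<longrightarrow> ereal s < \<infinity> \<longrightarrow> (F has_vector_derivative inverse (g s)) (at s)"
    using pos by (intro einterval_antiderivative continuous_intros contg) (auto simp: less_imp_neq [symmetric])
  then obtain F where F: "\<And>s. (F has_real_derivative inverse (g s)) (at s)"
    by (auto simp: has_real_derivative_iff_has_vector_derivative)
  define \<tau> where "\<tau> s = F s - F 0" for s
  have d\<tau>: "(\<tau> has_real_derivative inverse (g s)) (at s)" for s
    unfolding \<tau>_def using F [of s] by (auto intro!: derivative_eq_intros)
  have mono: "\<tau> a < \<tau> b" if "a < b" for a b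
    using that
  proof (rule DERIV_pos_imp_increasing)
    show "\<exists>y. (\<tau> has_real_derivative y) (at x) \<and> 0 < y" for x
      using d\<tau> [of x] pos [of x] by (intro exI [of _ "inverse (g x)"]) simp
  qed
  define T where "T = \<tau> 1"
  have \<tau>0: "\<tau> 0 = 0" by (simp add: \<tau>_def)
  have T: "T > 0" using mono [of 0 1] \<tau>0 by (simp add: T_def)
  have shift: "\<tau> (s + 1) = \<tau> s + T" for s
  proof -
    have "((\<lambda>s. \<tau> (s + 1) - \<tau> s) has_real_derivative 0) (at s)" for s
    proof -
      have "((\<lambda>s. \<tau> (s + 1)) has_real_derivative inverse (g (s + 1))) (at s)"
        using d\<tau> [of "s + 1"] by (simp add: DERIV_shift)
      from DERIV_diff [OF this d\<tau> [of s]] show ?thesis by (simp add: per)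
    qed
    from DERIV_isconst_all [of "\<lambda>s. \<tau> (s + 1) - \<tau> s" s 0, OF allI, OF this]
    show ?thesis using \<tau>0 by (simp add: T_def)
  qed
  have up: "\<tau> (real k) = real k * T" for k
  proof (induction k)
    case (Suc k)
    show ?case using shift [of "real k"] Suc by (simp add: algebra_simps)
  qed (simp add: \<tau>0)
  have down: "\<tau> (- real k) = - real k * T" for k
  proof (induction k)
    case (Suc k)
    show ?case using shift [of "- real (Suc k)"] Suc by (simp add: algebra_simps)
  qed (simp add: \<tau>0)
  have cont\<tau>: "isCont \<tau> s" for s using d\<tau> by (rule DERIV_isCont)
  have surj: "\<exists>s. \<tau> s = t" for t
  proof -
    obtain k where k: "real k > \<bar>t\<bar> / T" using reals_Archimedean2 by blast
    then have "\<bar>t\<bar> < real k * T" using T by (simp add: pos_divide_less_eq)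
    then have "\<tau> (- real k) \<le> t" "t \<le> \<tau> (real k)" using up [of k] down [of k] by simp_all
    moreover have "- real k \<le> real k" by simp
    ultimately show ?thesis using IVT [of \<tau> "- real k" t "real k"] cont\<tau> by blast
  qed
  have inj: "s = s'" if "\<tau> s = \<tau> s'" for s s' using mono that by (metis less_irrefl linorder_neqE)
  define \<theta> where "\<theta> t = (SOME s. \<tau> s = t)" for t
  have \<tau>\<theta>: "\<tau> (\<theta> t) = t" for t unfolding \<theta>_def using surj by (rule someI_ex)
  have \<theta>\<tau>: "\<theta> (\<tau> s) = s" for s using \<tau>\<theta> inj by blast
  show thesis
  proof (rule that [OF T])
    show "\<theta> 0 = 0" using \<theta>\<tau> [of 0] \<tau>0 by simp
    show "\<theta> (t + T) = \<theta> t + 1" for t using \<theta>\<tau> [of "\<theta> t + 1"] shift \<tau>\<theta> by simp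
    fix t
    have "isCont \<theta> (\<tau> (\<theta> t))"
      by (rule isCont_inverse_function2 [of "\<theta> t - 1" _ "\<theta> t + 1"]) (auto simp: \<theta>\<tau> cont\<tau>)
    then have "isCont \<theta> t" by (simp add: \<tau>\<theta>)
    moreover have "inverse (g (\<theta> t)) \<noteq> 0" using pos [of "\<theta> t"] by simp
    ultimately have "(\<theta> has_real_derivative inverse (inverse (g (\<theta> t)))) (at t)"
      using d\<tau> by (intro DERIV_inverse_function [where f = \<tau> and g = \<theta> and x = t and a = "t - 1" and b = "t + 1"]) (auto simp: \<tau>\<theta>)
    then show "(\<theta> has_real_derivative g (\<theta> t)) (at t)" by simp
  qed
qed

text \<open>The homotopy interpolates between the parameters \<open>s\<close> and
  \<open>\<theta> (T * s)\<close>. Both run from 0 to 1, so every intermediate loop closes up, and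
  it stays in \<open>S\<close> because \<open>x\<close> does so on the whole line.\<close>

lemma homotopic_loops_time_change:
  fixes x :: "real \<Rightarrow> 'a::topological_space"
  assumes x: "continuous_on UNIV x" "\<And>s. x s \<in> S" "\<And>s. x (s + 1) = x s"
    and \<theta>: "continuous_on UNIV \<theta>" "\<theta> 0 = 0" "\<theta> T = 1"
  shows "homotopic_loops S x (\<lambda>s. x (\<theta> (T * s)))"
  unfolding homotopic_loops
proof (intro exI conjI ballI)
  let ?h = "\<lambda>z. x ((1 - fst z) * snd z + fst z * \<theta> (T * snd z))"
  have "continuous_on ({0..1} \<times> {0..1}) (\<lambda>z::real\<times>real. \<theta> (T * snd z))"
    by (rule continuous_on_compose2 [OF \<theta>(1)]) (auto intro!: continuous_intros)
  then show "continuous_on ({0..1} \<times> {0..1}) ?h"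
    by (intro continuous_on_compose2 [OF x(1)]) (auto intro!: continuous_intros)
  show "?h \<in> {0..1} \<times> {0..1} \<rightarrow> S" using x(2) by auto
  show "pathfinish (?h \<circ> Pair t) = pathstart (?h \<circ> Pair t)" for t
    using x(3) [of 0] \<theta> by (simp add: pathfinish_def pathstart_def)
qed auto

section \<open>Energy of the closed extremal\<close>

context singular_conformal_factor
begin

text \<open>Twice the Hamiltonian of \<open>flow\<close>: along a solution \<open>|p|^2\<close> and
  \<open>U\<close> have the same logarithmic derivative wherever \<open>p\<close> does not vanish,
  and the quotient rule covers the other points.\<close>

lemma extremal_energy_constant:
  assumes Z: "\<And>s. x s \<notin> Z"
    and dx: "\<And>s. (x has_vector_derivative (1 / U (x s)) *\<^sub>R p s) (at s)"
    and dp: "\<And>s. (p has_vector_derivative ((norm (p s))\<^sup>2 / (2 * (U (x s))\<^sup>2)) *\<^sub>R G (x s)) (at s)"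
  shows "(norm (p s))\<^sup>2 / U (x s) = (norm (p 0))\<^sup>2 / U (x 0)"
proof -
  have "((\<lambda>s. (norm (p s))\<^sup>2 / U (x s)) has_real_derivative 0) (at s)" for s
  proof -
    let ?u = "U (x s)"
    have u: "?u > 0" using U_pos Z by blast
    let ?p' = "((norm (p s))\<^sup>2 / (2 * ?u\<^sup>2)) *\<^sub>R G (x s)"
    have "((\<lambda>s. p s \<bullet> p s) has_derivative (\<lambda>h. p s \<bullet> (h *\<^sub>R ?p') + (h *\<^sub>R ?p') \<bullet> p s)) (at s)"
      using dp [of s] unfolding has_vector_derivative_def by (intro has_derivative_inner)
    moreover have "(\<lambda>h. p s \<bullet> (h *\<^sub>R ?p') + (h *\<^sub>R ?p') \<bullet> p s) = (*) (2 * (p s \<bullet> ?p'))"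
      by (rule ext) (simp add: inner_commute)
    ultimately have 1: "((\<lambda>s. (norm (p s))\<^sup>2) has_real_derivative 2 * (p s \<bullet> ?p')) (at s)"
      by (simp only: has_field_derivative_def power2_norm_eq_inner)
    have "((\<lambda>s. U (x s)) has_derivative (\<lambda>h. (h *\<^sub>R ((1 / ?u) *\<^sub>R p s)) \<bullet> G (x s))) (at s)"
      using dx [of s] U_grad [OF Z [of s]] unfolding has_vector_derivative_def gderiv_def
      by (rule has_derivative_compose)
    moreover have "(\<lambda>h. (h *\<^sub>R ((1 / ?u) *\<^sub>R p s)) \<bullet> G (x s)) = (*) ((p s \<bullet> G (x s)) / ?u)"
      by (rule ext) simp
    ultimately have 2: "((\<lambda>s. U (x s)) has_real_derivative (p s \<bullet> G (x s)) / ?u) (at s)"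
      by (simp only: has_field_derivative_def)
    have "(2 * (p s \<bullet> ?p') * ?u - (norm (p s))\<^sup>2 * ((p s \<bullet> G (x s)) / ?u)) / (?u * ?u) = 0"
      using u by (simp add: power2_eq_square)
    with DERIV_divide [OF 1 2] u show ?thesis by simp
  qed
  then show ?thesis by (intro DERIV_isconst_all) auto
qed

theorem closed_extremal_with_energy_exists:
  assumes \<gamma>: "path \<gamma>" "path_image \<gamma> \<subseteq> - Z" "pathfinish \<gamma> = pathstart \<gamma>"
    and nontrivial: "\<And>a. a \<notin> Z \<Longrightarrow> \<not> homotopic_loops (- Z) \<gamma> (\<lambda>_. a)"
  obtains x p e where "\<And>s. x s \<notin> Z" "\<And>s. x (s + 1) = x s" "homotopic_loops (- Z) x \<gamma>"
    "\<And>s. (x has_vector_derivative (1 / U (x s)) *\<^sub>R p s) (at s)"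
    "\<And>s. (p has_vector_derivative (e / (2 * U (x s))) *\<^sub>R G (x s)) (at s)"
    "e > 0" "\<And>s. (norm (p s))\<^sup>2 = e * U (x s)"
proof -
  obtain x p where Z: "\<And>s. x s \<notin> Z" and per: "\<And>s. x (s + 1) = x s" and hom: "homotopic_loops (- Z) x \<gamma>"
    and dx: "\<And>s. (x has_vector_derivative (1 / U (x s)) *\<^sub>R p s) (at s)"
    and dp: "\<And>s. (p has_vector_derivative ((norm (p s))\<^sup>2 / (2 * (U (x s))\<^sup>2)) *\<^sub>R G (x s)) (at s)"
    using closed_extremal_exists [OF assms] by metis
  define e where "e = (norm (p 0))\<^sup>2 / U (x 0)"
  have u: "U (x s) > 0" for s using U_pos Z by blast
  have en: "(norm (p s))\<^sup>2 = e * U (x s)" for s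
    using extremal_energy_constant [OF Z dx dp, of s] u [of s] by (simp add: e_def divide_eq_eq)
  \<comment> \<open>Zero energy means \<open>p = 0\<close> throughout, hence a constant loop; this
    is where nontriviality keeps the extremal from degenerating.\<close>
  have "e \<noteq> 0"
  proof
    assume "e = 0"
    then have "(x has_vector_derivative 0) (at s within UNIV)" for s using dx [of s] en [of s] by simp
    then obtain a where "x s = a" for s
      using has_vector_derivative_zero_constant [of UNIV x] by auto
    then have "x = (\<lambda>_. a)" "a \<notin> Z" using Z by (auto simp: fun_eq_iff)
    then show False using hom nontrivial homotopic_loops_sym by metis
  qed
  moreover have "e \<ge> 0" using u [of 0] by (simp add: e_def)
  ultimately have "e > 0" by simp
  moreover have "(p has_vector_derivative (e / (2 * U (x s))) *\<^sub>R G (x s)) (at s)" for s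
    using dp [of s] u [of s] unfolding en by (simp add: power2_eq_square)
  ultimately show thesis using that Z per hom dx en by metis
qed

end

section \<open>The Jacobi metric of the relativistic problem\<close>

lemma GDERIV_sum:
  assumes "\<And>i. i \<in> I \<Longrightarrow> GDERIV (f i) x :> g i"
  shows "GDERIV (\<lambda>x. \<Sum>i\<in>I. f i x) x :> (\<Sum>i\<in>I. g i)"
  using assms unfolding gderiv_def inner_sum_right by (rule has_derivative_sum)

lemma GDERIV_power_potential:
  fixes a :: "'a::real_inner"
  assumes "x \<noteq> a" "\<alpha> \<noteq> 0"
  shows "GDERIV (\<lambda>x. k / (\<alpha> * norm (x - a) powr \<alpha>)) x :> - ((k / norm (x - a) powr (\<alpha> + 2)) *\<^sub>R (x - a))"
proof -
  let ?r = "norm (x - a)"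
  have r: "?r > 0" using assms by simp
  have "GDERIV (\<lambda>x. norm (x - a)) x :> sgn (x - a)"
  proof -
    have "((\<lambda>x. x - a) has_derivative (\<lambda>h. h)) (at x)" by (auto intro!: derivative_eq_intros)
    moreover have "(norm has_derivative (\<lambda>h. h \<bullet> sgn (x - a))) (at (x - a))"
      using GDERIV_norm [of "x - a"] assms by (simp add: gderiv_def)
    ultimately show ?thesis unfolding gderiv_def by (rule has_derivative_compose)
  qed
  moreover have "((\<lambda>r. k / (\<alpha> * r powr \<alpha>)) has_real_derivative - (k / ?r powr (\<alpha> + 1))) (at ?r)"
  proof -
    have "((\<lambda>r. k / \<alpha> * r powr (- \<alpha>)) has_real_derivative k / \<alpha> * (- \<alpha> * ?r powr (- \<alpha> - 1))) (at ?r)"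
      using r by (intro DERIV_cmult has_real_derivative_powr)
    moreover have "k / \<alpha> * (- \<alpha> * ?r powr (- \<alpha> - 1)) = - (k / ?r powr (\<alpha> + 1))"
      using assms powr_minus_divide [of ?r "\<alpha> + 1"] by simp
    moreover have "(\<lambda>r. k / \<alpha> * r powr (- \<alpha>)) = (\<lambda>r. k / (\<alpha> * r powr \<alpha>))"
      by (simp add: powr_minus_divide)
    ultimately show ?thesis by simp
  qed
  ultimately have "GDERIV (\<lambda>x. k / (\<alpha> * norm (x - a) powr \<alpha>)) x :> (- (k / ?r powr (\<alpha> + 1))) *\<^sub>R sgn (x - a)"
    by (rule GDERIV_DERIV_compose)
  moreover have "(- (k / ?r powr (\<alpha> + 1))) *\<^sub>R sgn (x - a) = - ((k / ?r powr (\<alpha> + 2)) *\<^sub>R (x - a))"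
  proof -
    have "?r powr (\<alpha> + 2) = ?r powr (\<alpha> + 1) * ?r"
      using r powr_add [of ?r "\<alpha> + 1" 1] by (simp add: add.assoc)
    then show ?thesis by (simp add: sgn_div_norm divide_inverse mult_ac)
  qed
  ultimately show ?thesis by simp
qed

lemma GDERIV_potential:
  assumes "x \<notin> \<sigma> ` {1..N}" "\<alpha> \<noteq> 0" "GDERIV W x :> gradW x"
  shows "GDERIV (potential N \<sigma> \<kappa> \<alpha> W) x :> force N \<sigma> \<kappa> \<alpha> gradW x"
proof -
  have "GDERIV (\<lambda>x. \<Sum>i=1..N. \<kappa> i / (\<alpha> * norm (x - \<sigma> i) powr \<alpha>)) x :>
      (\<Sum>i=1..N. - ((\<kappa> i / norm (x - \<sigma> i) powr (\<alpha> + 2)) *\<^sub>R (x - \<sigma> i)))"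
    using assms by (intro GDERIV_sum GDERIV_power_potential) auto
  from GDERIV_add [OF this assms(3)] show ?thesis
    unfolding potential_def [abs_def] force_def sum_negf .
qed

lemma continuous_on_force:
  assumes "continuous_on UNIV gradW"
  shows "continuous_on (- \<sigma> ` {1..N}) (force N \<sigma> \<kappa> \<alpha> gradW)"
  unfolding force_def [abs_def]
  by (intro continuous_intros continuous_on_subset [OF assms]) auto

text \<open>All summands are nonnegative, so it suffices to keep the term of the nearest centre,
  whose distance is the \<open>infdist\<close>.\<close>

lemma potential_ge:
  assumes "N \<ge> 1" "\<And>i. i \<in> {1..N} \<Longrightarrow> \<kappa> i > 0" "\<alpha> > 0" "W x > 0"
  shows "potential N \<sigma> \<kappa> \<alpha> W x \<ge> Min (\<kappa> ` {1..N}) / \<alpha> * infdist x (\<sigma> ` {1..N}) powr (- \<alpha>)"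
    and "potential N \<sigma> \<kappa> \<alpha> W x > 0"
proof -
  have nonneg: "0 \<le> \<kappa> i / (\<alpha> * norm (x - \<sigma> i) powr \<alpha>)" if "i \<in> {1..N}" for i
    using assms(2) [OF that] assms(3) by (simp add: less_imp_le)
  then have "(\<Sum>i=1..N. \<kappa> i / (\<alpha> * norm (x - \<sigma> i) powr \<alpha>)) \<ge> 0" by (intro sum_nonneg)
  then show "potential N \<sigma> \<kappa> \<alpha> W x > 0" using assms(4) by (simp add: potential_def)
  have "compact (\<sigma> ` {1..N})" "\<sigma> ` {1..N} \<noteq> {}" using assms(1) by (auto intro: finite_imp_compact)
  then obtain z where "z \<in> \<sigma> ` {1..N}" "infdist x (\<sigma> ` {1..N}) = dist x z"
    using infdist_attains_inf [of "\<sigma> ` {1..N}" x] compact_imp_closed by metis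
  then obtain i where i: "i \<in> {1..N}" "infdist x (\<sigma> ` {1..N}) = norm (x - \<sigma> i)" by (auto simp: dist_norm)
  have "Min (\<kappa> ` {1..N}) \<le> \<kappa> i" using i by (intro Min_le) auto
  then have "Min (\<kappa> ` {1..N}) / \<alpha> * norm (x - \<sigma> i) powr (- \<alpha>) \<le> \<kappa> i / \<alpha> * norm (x - \<sigma> i) powr (- \<alpha>)"
    using assms(3) by (intro mult_right_mono divide_right_mono) auto
  also have "\<dots> = \<kappa> i / (\<alpha> * norm (x - \<sigma> i) powr \<alpha>)" by (simp add: powr_minus_divide)
  also have "\<dots> \<le> (\<Sum>i=1..N. \<kappa> i / (\<alpha> * norm (x - \<sigma> i) powr \<alpha>))"
    using i nonneg by (intro member_le_sum) auto
  also have "\<dots> \<le> potential N \<sigma> \<kappa> \<alpha> W x" using assms(4) by (simp add: potential_def)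
  finally show "potential N \<sigma> \<kappa> \<alpha> W x \<ge> Min (\<kappa> ` {1..N}) / \<alpha> * infdist x (\<sigma> ` {1..N}) powr (- \<alpha>)"
    unfolding i(2) .
qed

text \<open>The right-hand side is the square of \<open>k * d powr (1 - \<alpha>)\<close>, which is
  unbounded as \<open>d\<close> tends to 0 precisely because \<alpha> > 1.\<close>

lemma powr_strong_force:
  fixes k \<alpha> B :: real
  assumes "k > 0" "\<alpha> > 1"
  obtains r where "r > 0" "\<And>d. 0 < d \<Longrightarrow> d < r \<Longrightarrow> B \<le> (k * d powr (- \<alpha>))\<^sup>2 * d\<^sup>2"
proof -
  \<comment> \<open>Chosen so that \<open>d powr (\<alpha> - 1) \<le> b\<close> says
    \<open>k * d powr (1 - \<alpha>) \<ge> sqrt \<bar>B\<bar> + 1\<close>; the \<open>+ 1\<close>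
    keeps the divisor positive when \<open>B = 0\<close>.\<close>
  define b where "b = k / (sqrt \<bar>B\<bar> + 1)"
  have s: "sqrt \<bar>B\<bar> + 1 > 0" by (simp add: add_nonneg_pos)
  then have b: "b > 0" using assms by (simp add: b_def)
  show thesis
  proof (rule that)
    show "b powr (1 / (\<alpha> - 1)) > 0" using b by simp
    fix d :: real assume d: "0 < d" "d < b powr (1 / (\<alpha> - 1))"
    have "d powr (\<alpha> - 1) \<le> (b powr (1 / (\<alpha> - 1))) powr (\<alpha> - 1)"
      using d assms by (intro powr_mono2) auto
    also have "\<dots> = b" using assms b by (simp add: powr_powr)
    finally have "d powr (\<alpha> - 1) * (sqrt \<bar>B\<bar> + 1) \<le> k"
      using s by (simp add: b_def pos_le_divide_eq)
    then have "sqrt \<bar>B\<bar> + 1 \<le> k / d powr (\<alpha> - 1)"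
      using d by (simp add: pos_le_divide_eq mult.commute)
    also have "k / d powr (\<alpha> - 1) = k * d powr (- \<alpha>) * d"
      using d powr_add [of d "- \<alpha>" 1] powr_minus_divide [of d "\<alpha> - 1"] by (simp add: mult.assoc)
    finally have "(sqrt \<bar>B\<bar>)\<^sup>2 \<le> (k * d powr (- \<alpha>) * d)\<^sup>2"
      by (intro power_mono) auto
    then show "B \<le> (k * d powr (- \<alpha>))\<^sup>2 * d\<^sup>2" by (simp add: power_mult_distrib)
  qed
qed

text \<open>Conformal factor of the Jacobi metric: with \<open>\<Omega> = h + mc\<^sup>2 + V\<close> the relativistic energy
  fixes the length of the momentum to \<open>sqrt (\<Omega>\<^sup>2 - m\<^sup>2c\<^sup>4) / c\<close>.\<close>

lemma singular_conformal_factor_jacobi: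
  fixes m c h \<alpha> :: real and \<sigma> :: "nat \<Rightarrow> real^2"
  assumes "N \<ge> 1" "\<And>i. i \<in> {1..N} \<Longrightarrow> \<kappa> i > 0" "\<alpha> > 1" "\<And>x. GDERIV W x :> gradW x"
    "continuous_on UNIV gradW" "\<And>x. W x > 0" "h > 0" "m > 0"
  defines "\<Omega> \<equiv> \<lambda>x. h + m * c\<^sup>2 + potential N \<sigma> \<kappa> \<alpha> W x"
  shows "singular_conformal_factor (\<sigma> ` {1..N}) (\<lambda>x. (\<Omega> x)\<^sup>2 - (m * c\<^sup>2)\<^sup>2)
    (\<lambda>x. (2 * \<Omega> x) *\<^sub>R force N \<sigma> \<kappa> \<alpha> gradW x) (h\<^sup>2)"
proof
  let ?Z = "\<sigma> ` {1..N}" and ?V = "potential N \<sigma> \<kappa> \<alpha> W"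
  have V: "?V x > 0" for x by (rule potential_ge) (use assms in auto)
  \<comment> \<open>The rest energy cancels up to a nonnegative cross term. What remains gives both
    the lower bound \<open>h^2\<close> and the growth like the square of the potential.\<close>
  have split: "(\<Omega> x)\<^sup>2 - (m * c\<^sup>2)\<^sup>2 \<ge> (h + ?V x)\<^sup>2" for x
  proof -
    have "(\<Omega> x)\<^sup>2 - (m * c\<^sup>2)\<^sup>2 = (h + ?V x)\<^sup>2 + 2 * ((m * c\<^sup>2) * (h + ?V x))"
      by (simp add: \<Omega>_def power2_eq_square algebra_simps)
    moreover have "(m * c\<^sup>2) * (h + ?V x) \<ge> 0"
      using V [of x] assms(7,8) by (intro mult_nonneg_nonneg) auto
    ultimately show ?thesis by linarith
  qed
  show "compact ?Z" "?Z \<noteq> {}" using assms(1) by (auto intro: finite_imp_compact)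
  show "h\<^sup>2 > 0" using assms by simp
  show "h\<^sup>2 \<le> (\<Omega> x)\<^sup>2 - (m * c\<^sup>2)\<^sup>2" for x
    using power_mono [of h "h + ?V x" 2] V [of x] assms(7) split [of x] by linarith
  have grad: "GDERIV ?V x :> force N \<sigma> \<kappa> \<alpha> gradW x" if "x \<notin> ?Z" for x
    using that assms by (intro GDERIV_potential) auto
  show "GDERIV (\<lambda>x. (\<Omega> x)\<^sup>2 - (m * c\<^sup>2)\<^sup>2) x :> (2 * \<Omega> x) *\<^sub>R force N \<sigma> \<kappa> \<alpha> gradW x" if "x \<notin> ?Z" for x
  proof -
    have "((\<lambda>v. (h + m * c\<^sup>2 + v)\<^sup>2 - (m * c\<^sup>2)\<^sup>2) has_real_derivative 2 * \<Omega> x) (at (?V x))"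
      by (auto intro!: derivative_eq_intros simp: \<Omega>_def)
    from GDERIV_DERIV_compose [OF grad [OF that] this] show ?thesis by (simp add: \<Omega>_def)
  qed
  have "continuous_on (- ?Z) ?V"
    using grad has_derivative_continuous unfolding gderiv_def
    by (intro continuous_at_imp_continuous_on) blast
  then show "continuous_on (- ?Z) (\<lambda>x. (2 * \<Omega> x) *\<^sub>R force N \<sigma> \<kappa> \<alpha> gradW x)"
    unfolding \<Omega>_def by (intro continuous_intros continuous_on_force assms)
  fix B :: real
  define k where "k = Min (\<kappa> ` {1..N}) / \<alpha>"
  have "Min (\<kappa> ` {1..N}) > 0" using assms(1,2) by (subst Min_gr_iff) auto
  then have k: "k > 0" using assms(3) by (simp add: k_def)
  obtain r where r: "r > 0" "\<And>d. 0 < d \<Longrightarrow> d < r \<Longrightarrow> B \<le> (k * d powr (- \<alpha>))\<^sup>2 * d\<^sup>2"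
    using powr_strong_force [OF k assms(3)] by metis
  have "B \<le> ((\<Omega> x)\<^sup>2 - (m * c\<^sup>2)\<^sup>2) * (infdist x ?Z)\<^sup>2" if x: "x \<notin> ?Z" "infdist x ?Z < r" for x
  proof -
    let ?d = "infdist x ?Z"
    have "?d > 0"
      using x(1) \<open>compact ?Z\<close> \<open>?Z \<noteq> {}\<close> in_closed_iff_infdist_zero [of ?Z x] infdist_nonneg [of x ?Z]
      by (simp add: compact_imp_closed less_le)
    then have "B \<le> (k * ?d powr (- \<alpha>))\<^sup>2 * ?d\<^sup>2" using r x(2) by blast
    also have "\<dots> \<le> (h + ?V x)\<^sup>2 * ?d\<^sup>2"
    proof (intro mult_right_mono power_mono)
      have "k * ?d powr (- \<alpha>) \<le> ?V x" unfolding k_def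
        by (rule potential_ge) (use assms in auto)
      then show "k * ?d powr (- \<alpha>) \<le> h + ?V x" using assms(7) by simp
    qed (use k in auto)
    also have "\<dots> \<le> ((\<Omega> x)\<^sup>2 - (m * c\<^sup>2)\<^sup>2) * ?d\<^sup>2"
      using split by (intro mult_right_mono) auto
    finally show ?thesis .
  qed
  then show "\<exists>r>0. \<forall>x. x \<notin> ?Z \<longrightarrow> infdist x ?Z < r \<longrightarrow> B \<le> ((\<Omega> x)\<^sup>2 - (m * c\<^sup>2)\<^sup>2) * (infdist x ?Z)\<^sup>2"
    using r(1) by blast
qed

section \<open>From the closed geodesic to the relativistic solution\<close>

theorem theorem3p1:
  fixes m c \<alpha> h :: real
    and N :: nat
    and \<sigma> :: "nat \<Rightarrow> real^2"
    and \<kappa> :: "nat \<Rightarrow> real"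
    and W :: "real^2 \<Rightarrow> real"
    and gradW :: "real^2 \<Rightarrow> real^2"
    and \<gamma> :: "real \<Rightarrow> real^2"
  assumes "m > 0" and "c > 0"
    and "N \<ge> 1"
    and "inj_on \<sigma> {1..N}"
    and "\<And>i. i \<in> {1..N} \<Longrightarrow> \<kappa> i > 0"
    and "\<alpha> > 1"
    and "\<And>x. GDERIV W x :> gradW x"
    and "continuous_on UNIV gradW"
    and "\<exists>M>0. \<forall>x. 0 < W x \<and> W x \<le> M"
    and "(gradW \<longlongrightarrow> 0) at_infinity"
    and "h > 0"
    and "loop_in (punctured_plane N \<sigma>) \<gamma>"
    and "nontrivial_class (punctured_plane N \<sigma>) \<gamma>"
  shows "\<exists>x. relativistic_solution m c (punctured_plane N \<sigma>) (force N \<sigma> \<kappa> \<alpha> gradW) x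
           \<and> has_energy m c (potential N \<sigma> \<kappa> \<alpha> W) x (h + m * c\<^sup>2)
           \<and> periodic_in_class (punctured_plane N \<sigma>) \<gamma> x"
proof -
  let ?Z = "\<sigma> ` {1..N}" and ?V = "potential N \<sigma> \<kappa> \<alpha> W" and ?F = "force N \<sigma> \<kappa> \<alpha> gradW"
  define \<Omega> where "\<Omega> x = h + m * c\<^sup>2 + ?V x" for x
  define U where "U x = (\<Omega> x)\<^sup>2 - (m * c\<^sup>2)\<^sup>2" for x
  have S: "punctured_plane N \<sigma> = - ?Z" by (simp add: punctured_plane_def Compl_eq_Diff_UNIV)
  have Wpos: "W x > 0" for x using assms(9) by blast
  have V: "?V x > 0" for x by (rule potential_ge) (use assms Wpos in auto)
  have mc: "m * c\<^sup>2 > 0" using assms by simp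
  have \<Omega>: "\<Omega> x > 0" for x using V [of x] mc assms(11) by (simp add: \<Omega>_def)
  interpret singular_conformal_factor ?Z U "\<lambda>x. (2 * \<Omega> x) *\<^sub>R ?F x" "h\<^sup>2"
    unfolding U_def \<Omega>_def by (rule singular_conformal_factor_jacobi) (use assms Wpos in auto)
  have \<gamma>: "path \<gamma>" "path_image \<gamma> \<subseteq> - ?Z" "pathfinish \<gamma> = pathstart \<gamma>"
    using assms(12) by (auto simp: loop_in_def S)
  have nontrivial: "\<not> homotopic_loops (- ?Z) \<gamma> (\<lambda>_. a)" if "a \<notin> ?Z" for a
    using assms(13) that by (auto simp: nontrivial_class_def S)
  obtain x p e where Z: "\<And>s. x s \<notin> ?Z" and per: "\<And>s. x (s + 1) = x s" and hom: "homotopic_loops (- ?Z) x \<gamma>"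
    and dx: "\<And>s. (x has_vector_derivative (1 / U (x s)) *\<^sub>R p s) (at s)"
    and dp: "\<And>s. (p has_vector_derivative (e / (2 * U (x s))) *\<^sub>R ((2 * \<Omega> (x s)) *\<^sub>R ?F (x s))) (at s)"
    and e: "e > 0" and en: "\<And>s. (norm (p s))\<^sup>2 = e * U (x s)"
    using closed_extremal_with_energy_exists [OF \<gamma> nontrivial] by metis
  have contx: "continuous_on UNIV x"
    using dx has_vector_derivative_continuous by (intro continuous_at_imp_continuous_on) blast
  have u: "U (x s) > 0" for s using U_pos [OF Z] .
  \<comment> \<open>The speed of the time change is dictated by the equation of motion. The energy
    requires a momentum of squared norm \<open>U / c^2\<close>, which
    \<open>p / (c * sqrt e)\<close> has; its time derivative is
    \<open>g * sqrt e * \<Omega> / (c * U)\<close> times the force, and \<open>g\<close> makes this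
    factor 1.\<close>
  define g where "g s = c * U (x s) / (sqrt e * \<Omega> (x s))" for s
  have gpos: "g s > 0" for s using u \<Omega> e assms(2) by (simp add: g_def)
  have "continuous_on UNIV g"
  proof -
    have "continuous_on (- ?Z) ?V"
      using GDERIV_potential [of _ \<sigma> N \<alpha> W gradW \<kappa>] assms(6,7) has_derivative_continuous unfolding gderiv_def
      by (intro continuous_at_imp_continuous_on) fastforce
    then have "continuous_on UNIV (\<lambda>s. ?V (x s))"
      by (rule continuous_on_compose2) (use contx Z in auto)
    then show ?thesis
      unfolding g_def U_def using \<Omega> e unfolding \<Omega>_def
      by (intro continuous_intros) (auto simp: less_imp_neq [symmetric])
  qed
  moreover have "g (s + 1) = g s" for s by (simp add: g_def per)
  ultimately obtain \<theta> T where T: "T > 0" and \<theta>: "\<theta> 0 = 0" "\<And>t. \<theta> (t + T) = \<theta> t + 1"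
    and d\<theta>: "\<And>t. (\<theta> has_real_derivative g (\<theta> t)) (at t)"
    using periodic_time_change [of g] gpos by metis
  define X where "X = x \<circ> \<theta>"
  have dX: "(X has_vector_derivative (c / (sqrt e * \<Omega> (X t))) *\<^sub>R p (\<theta> t)) (at t)" for t
  proof -
    have "((x \<circ> \<theta>) has_vector_derivative g (\<theta> t) *\<^sub>R ((1 / U (x (\<theta> t))) *\<^sub>R p (\<theta> t))) (at t)"
      using d\<theta> dx by (intro vector_diff_chain_at) (auto simp: has_real_derivative_iff_has_vector_derivative)
    moreover have "g (\<theta> t) * (1 / U (x (\<theta> t))) = c / (sqrt e * \<Omega> (X t))"
      using u [of "\<theta> t"] by (simp add: g_def X_def)
    ultimately show ?thesis by (simp add: X_def)
  qed
  have vel: "velocity X t = (c / (sqrt e * \<Omega> (X t))) *\<^sub>R p (\<theta> t)" for t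
    unfolding velocity_def using dX by (rule vector_derivative_at)
  \<comment> \<open>The squared speed is \<open>c^2 * U / \<Omega>^2\<close>, and \<open>U\<close>
    is \<open>\<Omega>^2\<close> minus the squared rest energy. Both the speed limit and the value
    of the energy are read off from this identity.\<close>
  have gamma: "1 - (norm (velocity X t))\<^sup>2 / c\<^sup>2 = (m * c\<^sup>2 / \<Omega> (X t))\<^sup>2" for t
  proof -
    have "(norm (velocity X t))\<^sup>2 / c\<^sup>2 = U (X t) / (\<Omega> (X t))\<^sup>2"
      using e assms(2) \<Omega> [of "X t"] en [of "\<theta> t"]
      unfolding vel by (simp add: power_mult_distrib power_divide X_def)
    then show ?thesis using \<Omega> [of "X t"] by (simp add: U_def diff_divide_distrib power_divide)
  qed
  have root: "sqrt (1 - (norm (velocity X t))\<^sup>2 / c\<^sup>2) = m * c\<^sup>2 / \<Omega> (X t)" for t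
    unfolding gamma using mc \<Omega> [of "X t"] by (simp add: less_imp_le)
  \<comment> \<open>The Lorentz factor \<open>\<Omega> / (m * c^2)\<close> cancels the
    \<open>\<Omega>\<close> in the velocity, so the relativistic momentum is a constant multiple of
    the geodesic one and is differentiable because \<open>p\<close> is.\<close>
  have mom: "momentum m c X = (\<lambda>t. (1 / (c * sqrt e)) *\<^sub>R p (\<theta> t))"
  proof
    fix t
    have "m / (m * c\<^sup>2 / \<Omega> (X t)) * (c / (sqrt e * \<Omega> (X t))) = 1 / (c * sqrt e)"
      using assms(1,2) e \<Omega> [of "X t"] by (simp add: power2_eq_square)
    then show "momentum m c X t = (1 / (c * sqrt e)) *\<^sub>R p (\<theta> t)"
      unfolding momentum_def root unfolding vel scaleR_scaleR by (simp only:)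
  qed
  have "relativistic_solution m c (- ?Z) ?F X"
    unfolding relativistic_solution_def
  proof (intro allI conjI)
    fix t
    show "X t \<in> - ?Z" using Z by (simp add: X_def)
    show "X differentiable at t" using dX by (rule differentiableI_vector)
    have "(norm (velocity X t))\<^sup>2 / c\<^sup>2 < 1"
      using gamma [of t] zero_less_power [OF divide_pos_pos [OF mc \<Omega> [of "X t"]], of 2] by linarith
    then have "(norm (velocity X t))\<^sup>2 < c\<^sup>2" using assms(2) by (simp add: divide_less_eq)
    then show "norm (velocity X t) < c" by (rule power2_less_imp_less) (use assms(2) in simp)
    have "((p \<circ> \<theta>) has_vector_derivative g (\<theta> t) *\<^sub>R
        ((e / (2 * U (x (\<theta> t)))) *\<^sub>R ((2 * \<Omega> (x (\<theta> t))) *\<^sub>R ?F (x (\<theta> t))))) (at t)"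
      using d\<theta> dp by (intro vector_diff_chain_at) (auto simp: has_real_derivative_iff_has_vector_derivative)
    then have "((\<lambda>t. (1 / (c * sqrt e)) *\<^sub>R p (\<theta> t)) has_vector_derivative (1 / (c * sqrt e)) *\<^sub>R (g (\<theta> t) *\<^sub>R
        ((e / (2 * U (x (\<theta> t)))) *\<^sub>R ((2 * \<Omega> (x (\<theta> t))) *\<^sub>R ?F (x (\<theta> t)))))) (at t)"
      unfolding o_def by (rule bounded_linear.has_vector_derivative [OF bounded_linear_scaleR_right])
    moreover have "1 / (c * sqrt e) * (g (\<theta> t) * (e / (2 * U (x (\<theta> t))) * (2 * \<Omega> (x (\<theta> t))))) = 1"
      using e assms(2) u [of "\<theta> t"] \<Omega> [of "x (\<theta> t)"] by (simp add: g_def)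
    ultimately show "(momentum m c X has_vector_derivative ?F (X t)) (at t)"
      unfolding mom unfolding X_def comp_apply scaleR_scaleR mult.assoc by (simp only: scaleR_one)
  qed
  moreover have "has_energy m c ?V X (h + m * c\<^sup>2)"
    unfolding has_energy_def root using assms(1,2) by (simp add: \<Omega>_def)
  moreover have "periodic_in_class (- ?Z) \<gamma> X"
    unfolding periodic_in_class_def
  proof (intro exI conjI)
    show "is_period X T" using T \<theta>(2) per by (simp add: is_period_def X_def)
    have "continuous_on UNIV \<theta>"
      using d\<theta> DERIV_isCont by (intro continuous_at_imp_continuous_on) blast
    moreover have "\<theta> T = 1" using \<theta>(1) \<theta>(2) [of 0] by simp
    ultimately have "homotopic_loops (- ?Z) x (\<lambda>s. x (\<theta> (T * s)))"
      using contx Z per \<theta>(1) by (intro homotopic_loops_time_change) auto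
    then show "homotopic_loops (- ?Z) (\<lambda>s. X (T * s)) \<gamma>"
      unfolding X_def comp_def using hom homotopic_loops_sym homotopic_loops_trans by blast
  qed
  ultimately show ?thesis unfolding S by blast
qed

end
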